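(* Let $(Y_i)$ be i.i.d. Bernoulli random variables with parameter $1/2$. Let $F_1\neq F_2$ be two c.d.f.s on $\mathbb{R}$ admitting continuous densities $g_1,g_2$ respectively, with finite variances and with means $\mu_1>\mu_2$. Let $(Z_i,Y_i)_{i}$ be i.i.d. where, conditionally on $Y_i$, $Z_i$ has density $Y_ig_1+(1-Y_i)g_2$. Consider the linear discriminant classifier and the 2-fold ($K=2$) cross-validated and split risks for the $0$–$1$ loss defined in the context. Set $$\mu:=\frac{\mu_1+\mu_2}2,\qquad\Delta:=g_1(\mu)-g_2(\mu),\qquad q:=\frac{F_1(\mu)-F_2(\mu)+1}2,$$ $$\sigma^2:=\frac{\Delta^2}8\Bigl[\mathrm{Var}_{g_1}(Z)+\mathrm{Var}_{g_2}(Z)+\tfrac12(\mu_1-\mu_2)^2\Bigr]+q(1-q),$$ $$\rho:=\frac\Delta4\Bigl[\mathbb{E}_{g_2}\bigl(Z\,\mathbb{I}(Z>\mu)\bigr)+\mathbb{E}_{g_1}\bigl(Z\,\mathbb{I}(Z\le\mu)\bigr)-2q\mu\Bigr].$$ Then, as $n\to\infty$, $$d_W\Bigl(\sqrt{\tfrac n2}\,\bigl[\hat R_{\mathrm{split}}-\overline R_{\frac n2,n}\bigr],\ \mathcal{N}(0,\sigma^2)\Bigr)\to0,\qquad d_W\Bigl(\sqrt n\,\bigl[\hat R_{\mathrm{cv}}-\overline R_{\frac n2,n}\bigr],\ \mathcal{N}(0,\sigma^2+2\rho)\Bigr)\to0 .$$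
   Context: $\mathbb{E}_{g_k}$ and $\mathrm{Var}_{g_k}$ denote expectation and variance when $Z$ has density $g_k$. $X_i=(Z_i,Y_i)$. Classifier: given a training sample of $m$ observations $(Z_i,Y_i)$, put $\hat\mu_1:=\frac2m\sum_iZ_i\,\mathbb{I}(Y_i=1)$ and $\hat\mu_2:=\frac2m\sum_iZ_i\,\mathbb{I}(Y_i=0)$ (sums over the training sample), and predict the label of a point $z\in\mathbb{R}$ by $C(z):=\mathbb{I}\{(z-\hat\mu_1)^2-(z-\hat\mu_2)^2<0\}$. The loss on $(z,y)$ is $\mathbb{I}(y\neq C(z))$. Risks: take $n$ even and let $B_1,B_2$ be a partition of $\{1,\dots,n\}$ into two folds of size $n/2$. Let $C^{(j)}$ be the classifier trained on the observations not in $B_j$. Then $\hat R_{\mathrm{split}}:=\frac2n\sum_{i\in B_1}\mathbb{I}(Y_i\neq C^{(1)}(Z_i))$ and $\hat R_{\mathrm{cv}}:=\frac1n\sum_{j=1}^2\sum_{i\in B_j}\mathbb{I}(Y_i\neq C^{(j)}(Z_i))$. $\overline R_{\frac n2,n}$ is the expected $0$–$1$ loss, on an independent new observation $(\tilde Z,\tilde Y)$ distributed as $(Z_1,Y_1)$, of the classifier trained on $n/2$ observations. $d_W$ is the Wasserstein-1 distance between distributions (a random variable stands for its law). *)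

theory Defs
  imports "HOL-Probability.Probability"
begin

definition law_of_density :: "(real \<Rightarrow> real) \<Rightarrow> real measure" where
  "law_of_density g = density lborel (\<lambda>z. ennreal (g z))"

definition cdf_with_continuous_density :: "(real \<Rightarrow> real) \<Rightarrow> (real \<Rightarrow> real) \<Rightarrow> bool" where
  "cdf_with_continuous_density F g \<longleftrightarrow>
     continuous_on UNIV g \<and> (\<forall>z. 0 \<le> g z) \<and>
     prob_space (law_of_density g) \<and> F = cdf (law_of_density g)"

definition expect :: "(real \<Rightarrow> real) \<Rightarrow> (real \<Rightarrow> real) \<Rightarrow> real" where
  "expect g h = prob_space.expectation (law_of_density g) h"

definition var :: "(real \<Rightarrow> real) \<Rightarrow> real" where
  "var g = prob_space.variance (law_of_density g) (\<lambda>z. z)"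

text \<open>The normal law with mean \<open>m\<close> and variance \<open>v \<ge> 0\<close>. The case \<open>v = 0\<close> (a point mass)
  has to be treated separately because the library's \<^const>\<open>normal_density\<close> with standard deviation
  \<open>0\<close> is not a probability density. It does occur as a limit law, for instance when the two classes are
  separated perfectly by the midpoint of their means.\<close>

definition normal_law :: "real \<Rightarrow> real \<Rightarrow> real measure" where
  "normal_law m v =
     (if v = 0 then return borel m else density lborel (\<lambda>x. ennreal (normal_density m (sqrt v) x)))"

definition couplings :: "real measure \<Rightarrow> real measure \<Rightarrow> (real \<times> real) measure set" where
  "couplings P Q =
     {\<gamma>. sets \<gamma> = sets (borel \<Otimes>\<^sub>M borel) \<and> distr \<gamma> borel fst = P \<and> distr \<gamma> borel snd = Q}"

text \<open>The value is in \<open>ennreal\<close>, so that an infinite transport cost is not silently read as \<open>0\<close>.\<close>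

definition wasserstein1 :: "real measure \<Rightarrow> real measure \<Rightarrow> ennreal" where
  "wasserstein1 P Q = (INF \<gamma>\<in>couplings P Q. \<integral>\<^sup>+(x, y). ennreal \<bar>x - y\<bar> \<partial>\<gamma>)"

text \<open>An observation is a pair \<open>(z, y)\<close>; the label \<open>1\<close> is \<^term>\<open>True\<close> and the label \<open>0\<close> is \<^term>\<open>False\<close>.
  A sample is a sequence of observations \<open>x\<close>, and \<open>T\<close> is the set of indices used for training.\<close>

abbreviation obs_space :: "(real \<times> bool) measure" where
  "obs_space \<equiv> borel \<Otimes>\<^sub>M count_space UNIV"

definition mu_hat :: "bool \<Rightarrow> nat set \<Rightarrow> (nat \<Rightarrow> real \<times> bool) \<Rightarrow> real" where
  "mu_hat c T x = 2 / real (card T) * (\<Sum>i\<in>T. fst (x i) * of_bool (snd (x i) = c))"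

definition classifier :: "nat set \<Rightarrow> (nat \<Rightarrow> real \<times> bool) \<Rightarrow> real \<Rightarrow> bool" where
  "classifier T x z \<longleftrightarrow> (z - mu_hat True T x)\<^sup>2 - (z - mu_hat False T x)\<^sup>2 < 0"

definition loss :: "nat set \<Rightarrow> (nat \<Rightarrow> real \<times> bool) \<Rightarrow> real \<times> bool \<Rightarrow> real" where
  "loss T x p = of_bool (snd p \<noteq> classifier T x (fst p))"

definition two_folds :: "nat \<Rightarrow> (nat \<Rightarrow> nat set) \<Rightarrow> bool" where
  "two_folds n B \<longleftrightarrow>
     B 1 \<union> B 2 = {1..n} \<and> B 1 \<inter> B 2 = {} \<and> card (B 1) = n div 2 \<and> card (B 2) = n div 2"

definition split_risk :: "nat \<Rightarrow> (nat \<Rightarrow> nat set) \<Rightarrow> (nat \<Rightarrow> real \<times> bool) \<Rightarrow> real" where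
  "split_risk n B x = 2 / real n * (\<Sum>i\<in>B 1. loss ({1..n} - B 1) x (x i))"

definition cv_risk :: "nat \<Rightarrow> (nat \<Rightarrow> nat set) \<Rightarrow> (nat \<Rightarrow> real \<times> bool) \<Rightarrow> real" where
  "cv_risk n B x = 1 / real n * (\<Sum>j=1..2. \<Sum>i\<in>B j. loss ({1..n} - B j) x (x i))"

text \<open>The expectation is over both the training sample \<open>X 1, \<dots>, X m\<close> and the new observation, whose
  independence of the sample is expressed by the product measure.\<close>

definition mean_risk :: "'a measure \<Rightarrow> (nat \<Rightarrow> 'a \<Rightarrow> real \<times> bool) \<Rightarrow> nat \<Rightarrow> real" where
  "mean_risk M X m =
     (\<integral>(\<omega>, p). loss {1..m} (\<lambda>i. X i \<omega>) p \<partial>(M \<Otimes>\<^sub>M distr M obs_space (X 1)))"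

end

(*
  Write k = n/2.  The classifier only depends on the pair u of class means, and as soon as these are
  in the right order it thresholds at their midpoint, which is just the average of the Z_i over the
  training fold.  Hence the conditional risk is R u = r t with t this average and r' (\<mu>) = \<Delta>/2.

  (1) Given the training fold, the sum over the test fold of (loss - R) - (loss at threshold \<mu> - q)
  consists of centred independent terms, and its variance divided by k tends to 0 in mean.
  (2) sqrt k * (R u - q - \<Delta>/2 * (t - \<mu>)) tends to 0 in L1, because
  |r t - r \<mu> - \<Delta>/2 * (t - \<mu>)| <= \<epsilon> * |t - \<mu>| + K * (t - \<mu>)^2 for all t.

  So up to an L1-error that vanishes, both rescaled risks are sums of independent terms
  U = (loss at threshold \<mu>) - q over the test observations and V = \<Delta>/2 * (Z - \<mu>) over the training
  observations.  In the split case U and V are evaluated at different observations, in the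
  cross-validated case every observation contributes U + V, whence the additional covariance 2 * \<rho>.
  The central limit theorem follows through characteristic functions, and is upgraded to
  Wasserstein-1 convergence by a Skorohod coupling and uniform integrability.
*)
theory Submission
  imports Defs
begin

section \<open>From characteristic functions to Wasserstein convergence\<close>

text \<open>Three facts shape the estimates. The class sums are normalised by 2/m and not by the
  class counts, so the midpoint and the difference of the class means are exact averages of i.i.d.
  terms, and both deviate from their limits by order k^(-1/2). The 0-1 loss jumps, so moving the
  threshold by d changes it with probability of order d; the variance in (1) is therefore of order
  |\<open>dev\<close>| and not \<open>dev\<close>^2, which still vanishes. The mean risk may replace
  q as the centring because the linear term has mean zero: their difference is the expected
  remainder. The approximation error is known to vanish only in L1, so the uniform integrability
  behind d_W is taken from the linear sums, which are bounded in L2. The limit variance may be 0,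
  and this case is carried along separately.\<close>

lemma (in prob_space) char_diff_le:
  fixes f g :: "'a \<Rightarrow> real"
  assumes [measurable]: "f \<in> borel_measurable M" "g \<in> borel_measurable M"
    and int: "integrable M (\<lambda>x. \<bar>f x - g x\<bar>)"
  shows "cmod (char (distr M borel f) t - char (distr M borel g) t) \<le> \<bar>t\<bar> * expectation (\<lambda>x. \<bar>f x - g x\<bar>)"
proof -
  have lip: "cmod (iexp a - iexp b) \<le> \<bar>a - b\<bar>" for a b :: real
  proof -
    have "cmod (iexp a - iexp b) = cmod (iexp b) * cmod (iexp (a - b) - 1)"
      unfolding norm_mult[symmetric] by (simp add: right_diff_distrib exp_diff)
    also have "\<dots> \<le> \<bar>a - b\<bar>"
      using iexp_approx1[of "a - b" 0] by simp
    finally show ?thesis .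
  qed
  have i: "integrable M (\<lambda>x. iexp (t * h x))" if [measurable]: "h \<in> borel_measurable M" for h
    by (rule integrable_iexp) auto
  have "cmod (char (distr M borel f) t - char (distr M borel g) t)
      = cmod (CLINT x|M. iexp (t * f x) - iexp (t * g x))"
    unfolding char_def using i[of f] i[of g] by (subst (1 2) integral_distr) auto
  also have "\<dots> \<le> expectation (\<lambda>x. cmod (iexp (t * f x) - iexp (t * g x)))"
    by (rule integral_norm_bound)
  also have "\<dots> \<le> expectation (\<lambda>x. \<bar>t\<bar> * \<bar>f x - g x\<bar>)"
  proof (rule integral_mono)
    show "integrable M (\<lambda>x. cmod (iexp (t * f x) - iexp (t * g x)))"
      by (intro integrable_norm Bochner_Integration.integrable_diff i) auto
    show "cmod (iexp (t * f x) - iexp (t * g x)) \<le> \<bar>t\<bar> * \<bar>f x - g x\<bar>" for x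
      using lip[of "t * f x" "t * g x"] by (simp add: abs_mult[symmetric] right_diff_distrib)
  qed (use int in auto)
  finally show ?thesis by simp
qed

text \<open>Continuous and bounded by K, so dominated convergence applies after truncation; the part
  cut off has size \<open>max 0 (\<bar>x\<bar> - K)\<close>.\<close>

definition clip :: "real \<Rightarrow> real \<Rightarrow> real" where
  "clip K x = max (- K) (min K x)"

lemma clip_measurable [measurable]: "clip K \<in> borel_measurable borel"
  unfolding clip_def by measurable

text \<open>Quantitative uniform integrability: a bound c on second moments makes the expected
  excess over K at most c / K.\<close>

lemma excess_le_square:
  assumes "K > 0"
  shows "max 0 (\<bar>x::real\<bar> - K) \<le> x\<^sup>2 / K"
proof -
  have "0 \<le> (\<bar>x\<bar> - K)\<^sup>2 + \<bar>x\<bar> * K" using assms by simp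
  also have "\<dots> = x\<^sup>2 - (\<bar>x\<bar> - K) * K" by (simp add: power2_eq_square algebra_simps)
  finally have "\<bar>x\<bar> - K \<le> x\<^sup>2 / K" using assms by (simp add: pos_le_divide_eq)
  then show ?thesis using assms by simp
qed

text \<open>Couple by Skorohod's theorem and truncate at level \<open>K\<close>; the excess beyond \<open>K\<close> is at most
  \<open>c / K\<close> plus the \<open>L\<^sup>1\<close>-error, because \<open>max 0 (\<bar>A\<bar> - K) \<le> S\<^sup>2 / K + \<bar>A - S\<bar>\<close>.\<close>

lemma wasserstein1_tendsto_0:
  fixes A S :: "nat \<Rightarrow> 'a \<Rightarrow> real" and Q :: "real measure"
  assumes M: "prob_space M" and Q: "real_distribution Q" and Q2: "integrable Q (\<lambda>x. x\<^sup>2)"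
    and [measurable]: "\<And>n. A n \<in> borel_measurable M" "\<And>n. S n \<in> borel_measurable M"
    and S2: "\<And>n. integrable M (\<lambda>x. (S n x)\<^sup>2)" "\<And>n. (\<integral>x. (S n x)\<^sup>2 \<partial>M) \<le> c"
    and diff: "\<And>n. integrable M (\<lambda>x. \<bar>A n x - S n x\<bar>)" "(\<lambda>n. \<integral>x. \<bar>A n x - S n x\<bar> \<partial>M) \<longlonglongrightarrow> 0"
    and char: "\<And>t. (\<lambda>n. char (distr M borel (S n)) t) \<longlonglongrightarrow> char Q t"
  shows "(\<lambda>n. wasserstein1 (distr M borel (A n)) Q) \<longlonglongrightarrow> 0"
proof -
  interpret prob_space M by (rule M)
  interpret Q: real_distribution Q by (rule Q)
  \<comment> \<open>\<open>A\<close> inherits the limit of the characteristic functions from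
    \<open>S\<close>, because these are \<bar>t\<bar>-Lipschitz for the L1 distance.\<close>
  have "(\<lambda>n. char (distr M borel (A n)) t) \<longlonglongrightarrow> char Q t" for t
  proof (rule Lim_transform[OF char])
    have "(\<lambda>n. \<bar>t\<bar> * (\<integral>x. \<bar>A n x - S n x\<bar> \<partial>M)) \<longlonglongrightarrow> 0"
      using tendsto_mult_right_zero[OF diff(2)] by simp
    then show "(\<lambda>n. char (distr M borel (A n)) t - char (distr M borel (S n)) t) \<longlonglongrightarrow> 0"
      by (rule Lim_null_comparison[rotated]) (auto intro!: always_eventually char_diff_le diff)
  qed
  then have "weak_conv_m (\<lambda>n. distr M borel (A n)) Q"
    by (intro levy_continuity Q) auto
  from Skorohod[OF real_distribution_distr Q this] obtain \<Omega> :: "real measure" and Ys :: "nat \<Rightarrow> real \<Rightarrow> real" and Y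
    where \<Omega>: "prob_space \<Omega>" and Ys [measurable]: "\<And>n. Ys n \<in> borel_measurable \<Omega>"
      and law: "\<And>n. distr \<Omega> borel (Ys n) = distr M borel (A n)"
      and Y': "Y \<in> measurable \<Omega> lborel" and lawY: "distr \<Omega> borel Y = Q"
      and lim: "\<And>x. x \<in> space \<Omega> \<Longrightarrow> (\<lambda>n. Ys n x) \<longlonglongrightarrow> Y x"
    by (simp, blast)
  have Y [measurable]: "Y \<in> borel_measurable \<Omega>" using Y' by simp
  interpret \<Omega>: prob_space \<Omega> by (rule \<Omega>)
  define e where "e n = (\<integral>x. \<bar>A n x - S n x\<bar> \<partial>M)" for n
  define d where "d = (\<integral>x. x\<^sup>2 \<partial>Q)"
  have d0: "d \<ge> 0" unfolding d_def by simp
  have "0 \<le> (\<integral>x. (S 0 x)\<^sup>2 \<partial>M)" by simp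
  with S2(2)[of 0] have c0: "c \<ge> 0" by linarith
  have iS: "integrable M (S n)" for n
    by (rule square_integrable_imp_integrable[OF _ S2(1)]) measurable
  \<comment> \<open>Only the L1 distance from \<open>A\<close> to the square integrable
    \<open>S\<close> is controlled, so integrability of \<open>A\<close> is recovered from
    \<open>(A - S) + S\<close>.\<close>
  have iA: "integrable M (A n)" for n
  proof -
    have "integrable M (\<lambda>x. A n x - S n x)"
      by (rule integrable_abs_cancel[OF diff(1)]) measurable
    from Bochner_Integration.integrable_add[OF this iS]
    have "integrable M (\<lambda>x. (A n x - S n x) + S n x)" .
    then show ?thesis by simp
  qed
  have iQ: "integrable Q (\<lambda>x. x)"
    by (rule Q.square_integrable_imp_integrable) (use Q2 in auto)
  have iYs: "integrable \<Omega> (Ys n)" for n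
  proof -
    have "integrable (distr M borel (A n)) (\<lambda>x. x)"
      by (subst integrable_distr_eq) (auto intro: iA)
    then show ?thesis unfolding law[symmetric] by (subst (asm) integrable_distr_eq) auto
  qed
  have iY: "integrable \<Omega> Y"
    using iQ unfolding lawY[symmetric] by (subst (asm) integrable_distr_eq) auto
  \<comment> \<open>The expected excess depends on the law alone, so it is computed on the original
    space, where \<open>S\<close> is at hand for comparison; \<open>S\<close> has no counterpart on
    the Skorohod space.\<close>
  have exA: "(\<integral>x. max 0 (\<bar>Ys n x\<bar> - K) \<partial>\<Omega>) \<le> c / K + e n" if K: "K > 0" for n K
  proof -
    have "(\<integral>x. max 0 (\<bar>Ys n x\<bar> - K) \<partial>\<Omega>) = (\<integral>x. max 0 (\<bar>A n x\<bar> - K) \<partial>M)"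
    proof -
      have "(\<lambda>x::real. max 0 (\<bar>x\<bar> - K)) \<in> borel_measurable borel" by measurable
      then show ?thesis
        using integral_distr[OF Ys, of "\<lambda>x. max 0 (\<bar>x\<bar> - K)" n]
          integral_distr[OF assms(4), of "\<lambda>x. max 0 (\<bar>x\<bar> - K)" n] unfolding law by metis
    qed
    also have "\<dots> \<le> (\<integral>x. (S n x)\<^sup>2 / K + \<bar>A n x - S n x\<bar> \<partial>M)"
    proof (rule integral_mono)
      show "integrable M (\<lambda>x. max 0 (\<bar>A n x\<bar> - K))"
        using iA by (intro Bochner_Integration.integrable_max) auto
      show "integrable M (\<lambda>x. (S n x)\<^sup>2 / K + \<bar>A n x - S n x\<bar>)"
        using S2 diff by auto
      show "max 0 (\<bar>A n x\<bar> - K) \<le> (S n x)\<^sup>2 / K + \<bar>A n x - S n x\<bar>" for x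
        using excess_le_square[OF K, of "S n x"] by linarith
    qed
    also have "\<dots> = (\<integral>x. (S n x)\<^sup>2 \<partial>M) / K + e n"
      unfolding e_def using S2 diff by (subst Bochner_Integration.integral_add) auto
    also have "\<dots> \<le> c / K + e n" using S2(2)[of n] K by (simp add: divide_right_mono)
    finally show ?thesis .
  qed
  have exY: "(\<integral>x. max 0 (\<bar>Y x\<bar> - K) \<partial>\<Omega>) \<le> d / K" if K: "K > 0" for K
  proof -
    have "(\<integral>x. max 0 (\<bar>Y x\<bar> - K) \<partial>\<Omega>) = (\<integral>x. max 0 (\<bar>x\<bar> - K) \<partial>Q)"
      using integral_distr[OF Y, of "\<lambda>x. max 0 (\<bar>x\<bar> - K)"] unfolding lawY by simp
    also have "\<dots> \<le> (\<integral>x. x\<^sup>2 / K \<partial>Q)"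
      using iQ Q2 excess_le_square[OF K]
      by (intro integral_mono Bochner_Integration.integrable_max) auto
    finally show ?thesis by (simp add: d_def)
  qed
  have clip: "(\<lambda>n. \<integral>x. \<bar>clip K (Ys n x) - clip K (Y x)\<bar> \<partial>\<Omega>) \<longlonglongrightarrow> 0" if K: "K > 0" for K
  proof -
    have "(\<lambda>n. \<integral>x. \<bar>clip K (Ys n x) - clip K (Y x)\<bar> \<partial>\<Omega>) \<longlonglongrightarrow> (\<integral>x. 0 \<partial>\<Omega>)"
    proof (rule integral_dominated_convergence[where w = "\<lambda>_. 2 * K"])
      show "AE x in \<Omega>. (\<lambda>n. \<bar>clip K (Ys n x) - clip K (Y x)\<bar>) \<longlonglongrightarrow> 0"
      proof (rule AE_I2)
        fix x assume "x \<in> space \<Omega>"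
        then have "(\<lambda>n. clip K (Ys n x)) \<longlonglongrightarrow> clip K (Y x)"
          unfolding clip_def by (intro tendsto_intros lim)
        then show "(\<lambda>n. \<bar>clip K (Ys n x) - clip K (Y x)\<bar>) \<longlonglongrightarrow> 0"
          using LIM_zero tendsto_rabs_zero by blast
      qed
    qed (use K in \<open>auto simp: clip_def\<close>)
    then show ?thesis by simp
  qed
  define w where "w n = (\<integral>x. \<bar>Ys n x - Y x\<bar> \<partial>\<Omega>)" for n
  have wle: "w n \<le> (\<integral>x. \<bar>clip K (Ys n x) - clip K (Y x)\<bar> \<partial>\<Omega>) + (c / K + e n) + d / K" if K: "K > 0" for n K
  proof -
    have ic: "integrable \<Omega> (\<lambda>x. \<bar>clip K (Ys n x) - clip K (Y x)\<bar>)"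
      by (rule \<Omega>.integrable_const_bound[where B = "2 * K"]) (use K in \<open>auto simp: clip_def\<close>)
    have im: "integrable \<Omega> (\<lambda>x. max 0 (\<bar>Ys n x\<bar> - K))" "integrable \<Omega> (\<lambda>x. max 0 (\<bar>Y x\<bar> - K))"
      using iYs iY by (auto intro!: Bochner_Integration.integrable_max)
    have "w n \<le> (\<integral>x. \<bar>clip K (Ys n x) - clip K (Y x)\<bar> + max 0 (\<bar>Ys n x\<bar> - K) + max 0 (\<bar>Y x\<bar> - K) \<partial>\<Omega>)"
      unfolding w_def
    proof (rule integral_mono)
      show "\<bar>Ys n x - Y x\<bar> \<le> \<bar>clip K (Ys n x) - clip K (Y x)\<bar> + max 0 (\<bar>Ys n x\<bar> - K) + max 0 (\<bar>Y x\<bar> - K)" for x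
        using K by (simp add: clip_def) linarith
    qed (use iYs iY ic im in auto)
    also have "\<dots> = (\<integral>x. \<bar>clip K (Ys n x) - clip K (Y x)\<bar> \<partial>\<Omega>) + (\<integral>x. max 0 (\<bar>Ys n x\<bar> - K) \<partial>\<Omega>) + (\<integral>x. max 0 (\<bar>Y x\<bar> - K) \<partial>\<Omega>)"
      using ic im by simp
    finally show ?thesis using exA[OF K, of n] exY[OF K] by linarith
  qed
  have w0: "w n \<ge> 0" for n unfolding w_def by simp
  have "w \<longlonglongrightarrow> 0"
  proof (rule LIMSEQ_I)
    fix r :: real assume r: "r > 0"
    \<comment> \<open>The two tails together cost (c + d) / K. This K makes that less than r / 2,
      and the added 1 keeps K positive when c + d = 0.\<close>
    define K where "K = (c + d + 1) * 2 / r"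
    have K: "K > 0" using r c0 d0 by (simp add: K_def)
    have "(c + d) / K < r / 2"
      using r c0 d0 by (simp add: K_def field_simps)
    then have less: "c / K + d / K < r / 2" by (simp add: add_divide_distrib)
    have "(\<lambda>n. (\<integral>x. \<bar>clip K (Ys n x) - clip K (Y x)\<bar> \<partial>\<Omega>) + e n) \<longlonglongrightarrow> 0"
      using tendsto_add[OF clip[OF K] diff(2)] by (simp add: e_def)
    from LIMSEQ_D[OF this, of "r / 2"] r obtain N where
      N: "\<And>n. n \<ge> N \<Longrightarrow> \<bar>(\<integral>x. \<bar>clip K (Ys n x) - clip K (Y x)\<bar> \<partial>\<Omega>) + e n\<bar> < r / 2" by auto
    show "\<exists>N. \<forall>n\<ge>N. norm (w n - 0) < r"
    proof (intro exI allI impI)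
      fix n assume "n \<ge> N"
      from N[OF this] wle[OF K, of n] less w0[of n] show "norm (w n - 0) < r"
        unfolding real_norm_def by linarith
    qed
  qed
  then have lim0: "(\<lambda>n. ennreal (w n)) \<longlonglongrightarrow> 0"
    using tendsto_ennrealI by fastforce
  have "wasserstein1 (distr M borel (A n)) Q \<le> ennreal (w n)" for n
  proof -
    \<comment> \<open>The joint law of the two Skorohod variables is an admissible coupling, and its
      transport cost is \<open>w n\<close>.\<close>
    let ?\<gamma> = "distr \<Omega> (borel \<Otimes>\<^sub>M borel) (\<lambda>x. (Ys n x, Y x))"
    have "?\<gamma> \<in> couplings (distr M borel (A n)) Q"
      by (auto simp: couplings_def distr_distr comp_def law lawY)
    then have "wasserstein1 (distr M borel (A n)) Q \<le> (\<integral>\<^sup>+(x, y). ennreal \<bar>x - y\<bar> \<partial>?\<gamma>)"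
      unfolding wasserstein1_def by (rule INF_lower)
    also have "\<dots> = (\<integral>\<^sup>+x. ennreal \<bar>Ys n x - Y x\<bar> \<partial>\<Omega>)"
      by (subst nn_integral_distr) auto
    also have "\<dots> = ennreal (w n)"
      unfolding w_def using iYs iY by (intro nn_integral_eq_integral) auto
    finally show ?thesis .
  qed
  then show ?thesis
    by (intro tendsto_sandwich[OF _ _ tendsto_const lim0]) auto
qed

section \<open>Moments and characteristic functions of the normal limit laws\<close>

lemma normal_law_facts:
  assumes "v \<ge> 0"
  shows "real_distribution (normal_law 0 v)" "integrable (normal_law 0 v) (\<lambda>x. x\<^sup>2)"
    and "char (normal_law 0 v) t = complex_of_real (exp (- v * t\<^sup>2 / 2))"
proof -
  have "real_distribution (normal_law 0 v) \<and> integrable (normal_law 0 v) (\<lambda>x. x\<^sup>2) \<and>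
     char (normal_law 0 v) t = complex_of_real (exp (- v * t\<^sup>2 / 2))"
  proof (cases "v = 0")
    case True
    have "prob_space (return borel (0::real))" by (rule prob_space_return) simp
    then have rd: "real_distribution (return borel (0::real))"
      by (auto simp: real_distribution_def real_distribution_axioms_def)
    have "integrable (return borel (0::real)) (\<lambda>x. x\<^sup>2)"
      by (subst integrable_iff_bounded) (auto simp: nn_integral_return)
    moreover have "char (return borel (0::real)) t = 1"
      unfolding char_def by (subst integral_return) auto
    ultimately show ?thesis using True rd by (simp add: normal_law_def)
  next
    case False
    define s where "s = sqrt v"
    have s: "s > 0" "s\<^sup>2 = v" using False assms by (auto simp: s_def)
    \<comment> \<open>Scaling a standard normal variable reduces both the second moment and the
      characteristic function to the standard case.\<close>
    have eq: "normal_law 0 v = distr std_normal_distribution borel (\<lambda>x. s * x)"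
    proof -
      interpret N: prob_space std_normal_distribution by (rule prob_space_normal_density) simp
      have "distributed std_normal_distribution lborel (\<lambda>x. x) (\<lambda>x. ennreal (std_normal_density x))"
        by (auto simp: distributed_def intro!: distr_id2)
      from N.normal_density_affine[OF this, of s 0] s
      have "distributed std_normal_distribution lborel (\<lambda>x. s * x) (\<lambda>x. ennreal (normal_density 0 s x))" by simp
      then have "distr std_normal_distribution lborel (\<lambda>x. s * x) = density lborel (\<lambda>x. ennreal (normal_density 0 s x))"
        by (auto simp: distributed_def)
      moreover have "distr std_normal_distribution lborel (\<lambda>x. s * x) = distr std_normal_distribution borel (\<lambda>x. s * x)"
        by (rule distr_cong) auto
      ultimately show ?thesis using False by (simp add: normal_law_def s_def)
    qed
    interpret N: real_distribution std_normal_distribution by (rule real_dist_normal_dist)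
    have "real_distribution (normal_law 0 v)"
      unfolding eq by (rule N.real_distribution_distr) simp
    moreover have "integrable (normal_law 0 v) (\<lambda>x. x\<^sup>2)"
      unfolding eq using integrable_std_normal_distribution_moment[of 2]
      by (subst integrable_distr_eq) (auto simp: power_mult_distrib)
    moreover have "char (normal_law 0 v) t = char std_normal_distribution (t * s)"
      unfolding eq char_def by (subst integral_distr) (auto simp: mult.assoc)
    ultimately show ?thesis
      using s by (simp add: char_std_normal_distribution power_mult_distrib mult.commute)
  qed
  then show "real_distribution (normal_law 0 v)" "integrable (normal_law 0 v) (\<lambda>x. x\<^sup>2)"
    "char (normal_law 0 v) t = complex_of_real (exp (- v * t\<^sup>2 / 2))" by auto
qed

section \<open>Sums over independent, identically distributed samples\<close>

text \<open>Stated for orthogonal and not for independent terms, because the test losses to which it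
  is applied share the training fold.\<close>

lemma (in prob_space) sum_orthogonal_square:
  fixes H :: "'i \<Rightarrow> 'a \<Rightarrow> real"
  assumes fin: "finite A"
    and [measurable]: "\<And>i. i \<in> A \<Longrightarrow> H i \<in> borel_measurable M"
    and sq: "\<And>i. i \<in> A \<Longrightarrow> integrable M (\<lambda>\<omega>. (H i \<omega>)\<^sup>2)"
    and orth: "\<And>i j. i \<in> A \<Longrightarrow> j \<in> A \<Longrightarrow> i \<noteq> j \<Longrightarrow> expectation (\<lambda>\<omega>. H i \<omega> * H j \<omega>) = 0"
  shows "integrable M (\<lambda>\<omega>. (\<Sum>i\<in>A. H i \<omega>)\<^sup>2)"
    and "expectation (\<lambda>\<omega>. (\<Sum>i\<in>A. H i \<omega>)\<^sup>2) = (\<Sum>i\<in>A. expectation (\<lambda>\<omega>. (H i \<omega>)\<^sup>2))"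
proof -
  have int: "integrable M (\<lambda>\<omega>. H i \<omega> * H j \<omega>)" if "i \<in> A" "j \<in> A" for i j
  proof (rule Bochner_Integration.integrable_bound)
    show "integrable M (\<lambda>\<omega>. (H i \<omega>)\<^sup>2 + (H j \<omega>)\<^sup>2)"
      using that by (intro Bochner_Integration.integrable_add sq)
    show "AE \<omega> in M. norm (H i \<omega> * H j \<omega>) \<le> norm ((H i \<omega>)\<^sup>2 + (H j \<omega>)\<^sup>2)"
    proof (rule AE_I2)
      fix \<omega>
      have "0 \<le> (\<bar>H i \<omega>\<bar> - \<bar>H j \<omega>\<bar>)\<^sup>2" "0 \<le> \<bar>H i \<omega>\<bar> * \<bar>H j \<omega>\<bar>" by simp_all
      then show "norm (H i \<omega> * H j \<omega>) \<le> norm ((H i \<omega>)\<^sup>2 + (H j \<omega>)\<^sup>2)"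
        unfolding power2_diff power2_abs real_norm_def abs_mult by linarith
    qed
  qed (use that in measurable)
  have eq: "(\<Sum>i\<in>A. H i \<omega>)\<^sup>2 = (\<Sum>i\<in>A. \<Sum>j\<in>A. H i \<omega> * H j \<omega>)" for \<omega>
    by (simp add: power2_eq_square sum_product)
  show "integrable M (\<lambda>\<omega>. (\<Sum>i\<in>A. H i \<omega>)\<^sup>2)"
    unfolding eq by (intro Bochner_Integration.integrable_sum int)
  have "expectation (\<lambda>\<omega>. (\<Sum>i\<in>A. H i \<omega>)\<^sup>2) = (\<Sum>i\<in>A. \<Sum>j\<in>A. expectation (\<lambda>\<omega>. H i \<omega> * H j \<omega>))"
    unfolding eq using int by (simp add: Bochner_Integration.integral_sum Bochner_Integration.integrable_sum)
  also have "\<dots> = (\<Sum>i\<in>A. \<Sum>j\<in>A. if j = i then expectation (\<lambda>\<omega>. (H i \<omega>)\<^sup>2) else 0)"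
    using orth by (intro sum.cong refl) (auto simp: power2_eq_square)
  also have "\<dots> = (\<Sum>i\<in>A. expectation (\<lambda>\<omega>. (H i \<omega>)\<^sup>2))"
    using fin by simp
  finally show "expectation (\<lambda>\<omega>. (\<Sum>i\<in>A. H i \<omega>)\<^sup>2) = (\<Sum>i\<in>A. expectation (\<lambda>\<omega>. (H i \<omega>)\<^sup>2))" .
qed

text \<open>Freezing: by Fubini on the product of the two laws, one of two independent arguments is
  held fixed while the other is integrated out. The bound \<open>C\<close> supplies integrability on
  the product.\<close>

lemma (in prob_space) indep_var_expectation:
  fixes k :: "'u \<times> 'u \<Rightarrow> real"
  assumes ind: "indep_var U \<zeta> N x" and k [measurable]: "k \<in> borel_measurable (U \<Otimes>\<^sub>M N)"
    and bound: "\<And>p. \<bar>k p\<bar> \<le> C"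
  shows "expectation (\<lambda>\<omega>. k (\<zeta> \<omega>, x \<omega>)) = expectation (\<lambda>\<omega>. \<integral>y. k (\<zeta> \<omega>, y) \<partial>distr M N x)"
proof -
  have [measurable]: "\<zeta> \<in> measurable M U" "x \<in> measurable M N"
    and joint: "distr M U \<zeta> \<Otimes>\<^sub>M distr M N x = distr M (U \<Otimes>\<^sub>M N) (\<lambda>\<omega>. (\<zeta> \<omega>, x \<omega>))"
    using ind unfolding indep_var_distribution_eq by auto
  interpret D1: prob_space "distr M U \<zeta>" by (rule prob_space_distr) simp
  interpret D2: prob_space "distr M N x" by (rule prob_space_distr) simp
  interpret D: pair_prob_space "distr M U \<zeta>" "distr M N x" ..
  have [measurable]: "(\<lambda>u. \<integral>y. k (u, y) \<partial>distr M N x) \<in> borel_measurable U"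
    by (rule D2.borel_measurable_lebesgue_integral) simp
  have "expectation (\<lambda>\<omega>. k (\<zeta> \<omega>, x \<omega>)) = (\<integral>p. k p \<partial>(distr M U \<zeta> \<Otimes>\<^sub>M distr M N x))"
    unfolding joint by (subst integral_distr) auto
  also have "\<dots> = (\<integral>u. \<integral>y. k (u, y) \<partial>distr M N x \<partial>distr M U \<zeta>)"
    by (rule D.integral_fst'[symmetric], rule D.integrable_const_bound[where B = C])
       (use bound in auto)
  also have "\<dots> = expectation (\<lambda>\<omega>. \<integral>y. k (\<zeta> \<omega>, y) \<partial>distr M N x)"
    by (subst integral_distr) auto
  finally show ?thesis .
qed

section \<open>Functions of disjoint blocks of an i.i.d. sample\<close>

locale iid_sample = prob_space M for M :: "'a measure" +
  fixes X :: "nat \<Rightarrow> 'a \<Rightarrow> 'b" and N :: "'b measure"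
  assumes indep: "indep_vars (\<lambda>_. N) X {1..}"
    and ident: "i \<ge> 1 \<Longrightarrow> distr M N (X i) = distr M N (X 1)"
begin

definition P :: "'b measure" where "P = distr M N (X 1)"

lemma X_measurable [measurable]: "i \<ge> 1 \<Longrightarrow> X i \<in> measurable M N"
  using indep unfolding indep_vars_def by auto

lemma X_measurable_Suc [measurable]: "X (Suc i) \<in> measurable M N"
  by (rule X_measurable) simp

lemma distr_X: "i \<ge> 1 \<Longrightarrow> distr M N (X i) = P"
  unfolding P_def by (rule ident)

lemma sets_P [measurable_cong, simp]: "sets P = sets N"
  and space_P [simp]: "space P = space N"
  by (auto simp: P_def)

sublocale P: prob_space P
  unfolding P_def by (rule prob_space_distr) (rule X_measurable, simp)

lemma expectation_X:
  fixes f :: "'b \<Rightarrow> real"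
  assumes "i \<ge> 1" and f: "f \<in> borel_measurable N"
  shows "expectation (\<lambda>\<omega>. f (X i \<omega>)) = (\<integral>x. f x \<partial>P)"
  using assms by (subst distr_X[OF assms(1), symmetric], subst integral_distr) auto

lemma integrable_X:
  fixes f :: "'b \<Rightarrow> real"
  assumes "i \<ge> 1" and f: "f \<in> borel_measurable N"
  shows "integrable M (\<lambda>\<omega>. f (X i \<omega>)) \<longleftrightarrow> integrable P f"
  using assms by (subst distr_X[OF assms(1), symmetric], subst integrable_distr_eq) auto

lemma distr_comp_X:
  assumes "i \<ge> 1" and f: "f \<in> borel_measurable N"
  shows "distr M borel (\<lambda>\<omega>. f (X i \<omega>)) = distr P borel f"
  using assms by (subst distr_X[OF assms(1), symmetric], subst distr_distr) (auto simp: comp_def)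

text \<open>Conditioning on a block of observations, expressed without conditional expectations: a
  statistic of the block \<open>T\<close> is independent of \<open>X j\<close>, so
  \<open>X j\<close> is integrated out with the statistic frozen. Going through
  \<open>restrict\<close> makes the statistic a measurable function on the product space over
  \<open>T\<close>, where independence of disjoint index sets applies.\<close>

lemma block_expectation:
  fixes k :: "'u \<times> 'b \<Rightarrow> real"
  assumes T: "T \<subseteq> {1..}" and j: "j \<ge> 1" "j \<notin> T" and F [measurable]: "F \<in> measurable (PiM T (\<lambda>_. N)) U"
    and k [measurable]: "k \<in> borel_measurable (U \<Otimes>\<^sub>M N)" and bound: "\<And>p. \<bar>k p\<bar> \<le> C"
  defines "\<xi> \<equiv> \<lambda>\<omega>. F (restrict (\<lambda>i. X i \<omega>) T)"
  shows "expectation (\<lambda>\<omega>. k (\<xi> \<omega>, X j \<omega>)) = expectation (\<lambda>\<omega>. \<integral>y. k (\<xi> \<omega>, y) \<partial>P)"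
proof -
  have ind: "indep_var (PiM T (\<lambda>_. N)) (\<lambda>\<omega>. restrict (\<lambda>i. X i \<omega>) T) (PiM {j} (\<lambda>_. N)) (\<lambda>\<omega>. restrict (\<lambda>i. X i \<omega>) {j})"
    by (rule indep_var_restrict[OF indep]) (use T j in auto)
  have [measurable]: "X j \<in> measurable M N" using j by simp
  have RT [measurable]: "(\<lambda>\<omega>. restrict (\<lambda>i. X i \<omega>) T) \<in> measurable M (PiM T (\<lambda>_. N))"
    using T by (intro measurable_restrict X_measurable) auto
  have \<xi> [measurable]: "\<xi> \<in> measurable M U"
    unfolding \<xi>_def by measurable
  have [measurable]: "(\<lambda>\<omega>. restrict (\<lambda>i. X i \<omega>) {j}) \<in> measurable M (PiM {j} (\<lambda>_. N))"
    using j by (intro measurable_restrict) auto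
  have "expectation (\<lambda>\<omega>. k (\<xi> \<omega>, X j \<omega>))
      = expectation (\<lambda>\<omega>. (\<lambda>(f, g). k (F f, g j)) (restrict (\<lambda>i. X i \<omega>) T, restrict (\<lambda>i. X i \<omega>) {j}))"
    by (simp add: \<xi>_def)
  also have "\<dots> = expectation (\<lambda>\<omega>. \<integral>g. (\<lambda>(f, g). k (F f, g j)) (restrict (\<lambda>i. X i \<omega>) T, g)
      \<partial>distr M (PiM {j} (\<lambda>_. N)) (\<lambda>\<omega>. restrict (\<lambda>i. X i \<omega>) {j}))"
    by (rule indep_var_expectation[OF ind, where C = C]) (use bound in auto)
  also have "\<dots> = expectation (\<lambda>\<omega>. \<integral>y. k (\<xi> \<omega>, y) \<partial>P)"
  proof (rule Bochner_Integration.integral_cong[OF refl])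
    fix \<omega> assume \<omega>: "\<omega> \<in> space M"
    have [measurable]: "(\<lambda>y. k (\<xi> \<omega>, y)) \<in> borel_measurable N"
      using measurable_space[OF \<xi> \<omega>] by measurable
    show "(\<integral>g. (\<lambda>(f, g). k (F f, g j)) (restrict (\<lambda>i. X i \<omega>) T, g)
        \<partial>distr M (PiM {j} (\<lambda>_. N)) (\<lambda>\<omega>. restrict (\<lambda>i. X i \<omega>) {j})) = (\<integral>y. k (\<xi> \<omega>, y) \<partial>P)"
    proof -
      have "(\<integral>g. k (\<xi> \<omega>, g j) \<partial>distr M (PiM {j} (\<lambda>_. N)) (\<lambda>\<omega>. restrict (\<lambda>i. X i \<omega>) {j}))
          = expectation (\<lambda>\<omega>'. k (\<xi> \<omega>, X j \<omega>'))"
        by (subst integral_distr) auto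
      also have "\<dots> = (\<integral>y. k (\<xi> \<omega>, y) \<partial>P)"
        by (rule expectation_X) (use j in auto)
      finally show ?thesis by (simp add: \<xi>_def)
    qed
  qed
  finally show ?thesis .
qed

lemma sum_iid_square:
  fixes f :: "'b \<Rightarrow> real"
  assumes A: "finite A" "A \<subseteq> {1..}" and f [measurable]: "f \<in> borel_measurable N"
    and sq: "integrable P (\<lambda>x. (f x)\<^sup>2)" and mean: "(\<integral>x. f x \<partial>P) = 0"
  shows "integrable M (\<lambda>\<omega>. (\<Sum>i\<in>A. f (X i \<omega>))\<^sup>2)"
    and "expectation (\<lambda>\<omega>. (\<Sum>i\<in>A. f (X i \<omega>))\<^sup>2) = real (card A) * (\<integral>x. (f x)\<^sup>2 \<partial>P)"
proof -
  have iP: "integrable P f" by (rule P.square_integrable_imp_integrable[OF _ sq]) simp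
  have [measurable]: "X i \<in> measurable M N" if "i \<in> A" for i using A that by auto
  have sqX: "integrable M (\<lambda>\<omega>. (f (X i \<omega>))\<^sup>2)" "expectation (\<lambda>\<omega>. (f (X i \<omega>))\<^sup>2) = (\<integral>x. (f x)\<^sup>2 \<partial>P)"
    if "i \<in> A" for i
    using that A sq integrable_X[of i "\<lambda>x. (f x)\<^sup>2"] expectation_X[of i "\<lambda>x. (f x)\<^sup>2"] by auto
  have orth: "expectation (\<lambda>\<omega>. f (X i \<omega>) * f (X j \<omega>)) = 0" if ij: "i \<in> A" "j \<in> A" "i \<noteq> j" for i j
  proof -
    have i1: "i \<ge> 1" "j \<ge> 1" using ij A by auto
    have "indep_var (PiM {i} (\<lambda>_. N)) (\<lambda>\<omega>. restrict (\<lambda>i. X i \<omega>) {i}) (PiM {j} (\<lambda>_. N)) (\<lambda>\<omega>. restrict (\<lambda>i. X i \<omega>) {j})"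
      by (rule indep_var_restrict[OF indep]) (use i1 ij in auto)
    from indep_var_compose[OF this, of "\<lambda>u. f (u i)" borel "\<lambda>u. f (u j)" borel]
    have "indep_var borel (\<lambda>\<omega>. f (X i \<omega>)) borel (\<lambda>\<omega>. f (X j \<omega>))" by (simp add: comp_def)
    from indep_var_lebesgue_integral[OF this] i1
    show ?thesis by (simp add: integrable_X iP expectation_X mean)
  qed
  show "integrable M (\<lambda>\<omega>. (\<Sum>i\<in>A. f (X i \<omega>))\<^sup>2)"
    by (rule sum_orthogonal_square) (use A sqX orth in auto)
  have "expectation (\<lambda>\<omega>. (\<Sum>i\<in>A. f (X i \<omega>))\<^sup>2) = (\<Sum>i\<in>A. expectation (\<lambda>\<omega>. (f (X i \<omega>))\<^sup>2))"
    by (rule sum_orthogonal_square) (use A sqX orth in auto)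
  then show "expectation (\<lambda>\<omega>. (\<Sum>i\<in>A. f (X i \<omega>))\<^sup>2) = real (card A) * (\<integral>x. (f x)\<^sup>2 \<partial>P)"
    using sqX by simp
qed

text \<open>Given the block \<open>T\<close> the summands are independent and centred.
  Unconditionally they depend on each other through \<open>\<xi>\<close>, but they remain
  orthogonal, and the variance of the sum is still additive.\<close>

lemma sum_conditional_square:
  fixes h :: "'u \<Rightarrow> 'b \<Rightarrow> real"
  assumes A: "finite A" "A \<subseteq> {1..}" "T \<subseteq> {1..}" "A \<inter> T = {}"
    and F [measurable]: "F \<in> measurable (PiM T (\<lambda>_. N)) U"
    and h [measurable]: "case_prod h \<in> borel_measurable (U \<Otimes>\<^sub>M N)"
    and bound: "\<And>u x. \<bar>h u x\<bar> \<le> C" and mean: "\<And>u. (\<integral>x. h u x \<partial>P) = 0"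
  defines "\<xi> \<equiv> \<lambda>\<omega>. F (restrict (\<lambda>i. X i \<omega>) T)"
  shows "integrable M (\<lambda>\<omega>. (\<Sum>i\<in>A. h (\<xi> \<omega>) (X i \<omega>))\<^sup>2)"
    and "expectation (\<lambda>\<omega>. (\<Sum>i\<in>A. h (\<xi> \<omega>) (X i \<omega>))\<^sup>2)
      = real (card A) * expectation (\<lambda>\<omega>. \<integral>x. (h (\<xi> \<omega>) x)\<^sup>2 \<partial>P)"
proof -
  have X [measurable]: "X i \<in> measurable M N" if "i \<in> A" for i using A that by auto
  have [measurable]: "\<xi> \<in> measurable M U"
    unfolding \<xi>_def using A(3) by (intro measurable_compose[OF measurable_restrict F]) auto
  have C: "C \<ge> 0" using bound[of undefined undefined] by linarith
  have mult: "\<bar>a * b\<bar> \<le> C * C" if "\<bar>a\<bar> \<le> C" "\<bar>b\<bar> \<le> C" for a b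
    using that C unfolding abs_mult by (intro mult_mono) auto
  have sqX: "integrable M (\<lambda>\<omega>. (h (\<xi> \<omega>) (X i \<omega>))\<^sup>2)"
     "expectation (\<lambda>\<omega>. (h (\<xi> \<omega>) (X i \<omega>))\<^sup>2) = expectation (\<lambda>\<omega>. \<integral>x. (h (\<xi> \<omega>) x)\<^sup>2 \<partial>P)"
    if i: "i \<in> A" for i
  proof -
    have [measurable]: "X i \<in> measurable M N" using i by simp
    show "integrable M (\<lambda>\<omega>. (h (\<xi> \<omega>) (X i \<omega>))\<^sup>2)"
      unfolding power2_eq_square
      by (rule integrable_const_bound[where B = "C * C", OF AE_I2]) (simp_all only: real_norm_def mult bound, measurable)
    have "expectation (\<lambda>\<omega>. (\<lambda>(u, x). (h u x)\<^sup>2) (\<xi> \<omega>, X i \<omega>))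
        = expectation (\<lambda>\<omega>. \<integral>x. (\<lambda>(u, x). (h u x)\<^sup>2) (\<xi> \<omega>, x) \<partial>P)"
      unfolding \<xi>_def by (rule block_expectation[OF A(3) _ _ F, where C = "C * C"])
         (use i A in \<open>auto simp: power2_eq_square intro!: mult bound simp del: abs_mult_self_eq\<close>)
    then show "expectation (\<lambda>\<omega>. (h (\<xi> \<omega>) (X i \<omega>))\<^sup>2) = expectation (\<lambda>\<omega>. \<integral>x. (h (\<xi> \<omega>) x)\<^sup>2 \<partial>P)"
      by simp
  qed
  have orth: "expectation (\<lambda>\<omega>. h (\<xi> \<omega>) (X i \<omega>) * h (\<xi> \<omega>) (X j \<omega>)) = 0"
    if ij: "i \<in> A" "j \<in> A" "i \<noteq> j" for i j
  proof -
    \<comment> \<open>The block is enlarged by i, so that \<open>X j\<close> alone lies outside it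
      and the centring of \<open>h\<close> makes the inner integral vanish.\<close>
    let ?F = "\<lambda>f. (F (restrict f T), f i)"
    let ?k = "\<lambda>q. h (fst (fst q)) (snd (fst q)) * h (fst (fst q)) (snd q)"
    have "?F \<in> measurable (PiM (insert i T) (\<lambda>_. N)) (U \<Otimes>\<^sub>M N)"
      by (intro measurable_Pair measurable_compose[OF measurable_restrict_subset F]) auto
    then have "expectation (\<lambda>\<omega>. ?k (?F (restrict (\<lambda>i. X i \<omega>) (insert i T)), X j \<omega>))
        = expectation (\<lambda>\<omega>. \<integral>y. ?k (?F (restrict (\<lambda>i. X i \<omega>) (insert i T)), y) \<partial>P)"
    proof (rule block_expectation[rotated 3])
      show "?k \<in> borel_measurable ((U \<Otimes>\<^sub>M N) \<Otimes>\<^sub>M N)" by measurable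
      show "\<bar>?k p\<bar> \<le> C * C" for p by (intro mult bound)
    qed (use ij A in auto)
    moreover have "restrict (restrict (\<lambda>i. X i \<omega>) (insert i T)) T = restrict (\<lambda>i. X i \<omega>) T" for \<omega>
      by (auto simp: restrict_def)
    ultimately have "expectation (\<lambda>\<omega>. h (\<xi> \<omega>) (X i \<omega>) * h (\<xi> \<omega>) (X j \<omega>))
        = expectation (\<lambda>\<omega>. \<integral>y. h (\<xi> \<omega>) (X i \<omega>) * h (\<xi> \<omega>) y \<partial>P)"
      by (simp add: \<xi>_def)
    also have "\<dots> = 0" by (simp add: mean)
    finally show ?thesis by simp
  qed
  show "integrable M (\<lambda>\<omega>. (\<Sum>i\<in>A. h (\<xi> \<omega>) (X i \<omega>))\<^sup>2)"
    by (rule sum_orthogonal_square) (use A sqX orth in auto)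
  have "expectation (\<lambda>\<omega>. (\<Sum>i\<in>A. h (\<xi> \<omega>) (X i \<omega>))\<^sup>2) = (\<Sum>i\<in>A. expectation (\<lambda>\<omega>. (h (\<xi> \<omega>) (X i \<omega>))\<^sup>2))"
    by (rule sum_orthogonal_square) (use A sqX orth in auto)
  then show "expectation (\<lambda>\<omega>. (\<Sum>i\<in>A. h (\<xi> \<omega>) (X i \<omega>))\<^sup>2)
      = real (card A) * expectation (\<lambda>\<omega>. \<integral>x. (h (\<xi> \<omega>) x)\<^sup>2 \<partial>P)"
    using sqX by simp
qed

text \<open>The summand may change with the index because the split risk carries \<open>U\<close> on
  the test fold and \<open>V\<close> on the training fold.\<close>

lemma char_sum:
  fixes f :: "nat \<Rightarrow> 'b \<Rightarrow> real"
  assumes A: "A \<subseteq> {1..}" and f [measurable]: "\<And>i. i \<in> A \<Longrightarrow> f i \<in> borel_measurable N"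
  shows "char (distr M borel (\<lambda>\<omega>. c * (\<Sum>i\<in>A. f i (X i \<omega>)))) t = (\<Prod>i\<in>A. char (distr P borel (f i)) (c * t))"
proof -
  have "indep_vars (\<lambda>_. borel) (\<lambda>i \<omega>. f i (X i \<omega>)) A"
    by (rule indep_vars_compose2[OF indep_vars_subset[OF indep A]]) (use f in auto)
  then have "char (distr M borel (\<lambda>\<omega>. \<Sum>i\<in>A. f i (X i \<omega>))) s = (\<Prod>i\<in>A. char (distr M borel (\<lambda>\<omega>. f i (X i \<omega>))) s)" for s
    by (rule char_distr_sum)
  also have "(\<Prod>i\<in>A. char (distr M borel (\<lambda>\<omega>. f i (X i \<omega>))) s) = (\<Prod>i\<in>A. char (distr P borel (f i)) s)" for s
    using A by (intro prod.cong refl arg_cong2[where f = char] distr_comp_X) auto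
  finally have "char (distr M borel (\<lambda>\<omega>. \<Sum>i\<in>A. f i (X i \<omega>))) (c * t) = (\<Prod>i\<in>A. char (distr P borel (f i)) (c * t))" .
  moreover have "(\<lambda>\<omega>. \<Sum>i\<in>A. f i (X i \<omega>)) \<in> borel_measurable M"
    using A f by (intro borel_measurable_sum measurable_compose[OF X_measurable f]) auto
  ultimately show ?thesis
    by (simp add: char_def integral_distr mult_ac)
qed

text \<open>The central limit theorem as a limit of powers of one characteristic function. In this
  form it can be multiplied over two folds and read along n = 2 k.\<close>

lemma char_power_tendsto:
  fixes f :: "'b \<Rightarrow> real"
  assumes f [measurable]: "f \<in> borel_measurable N"
    and sq: "integrable P (\<lambda>x. (f x)\<^sup>2)" and mean: "(\<integral>x. f x \<partial>P) = 0"
  shows "(\<lambda>n. char (distr P borel f) (t / sqrt (real n)) ^ n)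
    \<longlonglongrightarrow> complex_of_real (exp (- (\<integral>x. (f x)\<^sup>2 \<partial>P) * t\<^sup>2 / 2))"
proof (cases "(\<integral>x. (f x)\<^sup>2 \<partial>P) = 0")
  case True
  \<comment> \<open>A function with second moment zero vanishes almost surely, so its characteristic
    function is constantly 1, in agreement with a point mass at 0.\<close>
  then have "AE x in P. (f x)\<^sup>2 = 0"
    using integral_nonneg_eq_0_iff_AE[OF sq] by simp
  then have ae: "AE x in P. f x = 0" by simp
  have "char (distr P borel f) s = (CLINT x|P. iexp (s * f x))" for s
    unfolding char_def by (subst integral_distr) auto
  also have "\<dots> s = (CLINT x|P. 1)" for s
    by (rule integral_cong_AE) (use ae in auto)
  finally have "char (distr P borel f) s = 1" for s using P.prob_space by simp
  with True show ?thesis by simp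
next
  case False
  define \<sigma> where "\<sigma> = sqrt (\<integral>x. (f x)\<^sup>2 \<partial>P)"
  have "(\<integral>x. (f x)\<^sup>2 \<partial>P) \<ge> 0" by simp
  with False have "(\<integral>x. (f x)\<^sup>2 \<partial>P) > 0" by linarith
  then have \<sigma>: "\<sigma> > 0" "(\<integral>x. (f x)\<^sup>2 \<partial>P) = \<sigma>\<^sup>2" by (auto simp: \<sigma>_def)
  \<comment> \<open>The sample is indexed from 1 and the central limit theorem from 0; singleton
    blocks carry out the shift.\<close>
  have "indep_vars (\<lambda>j. PiM {Suc j} (\<lambda>_. N)) (\<lambda>j \<omega>. restrict (\<lambda>i. X i \<omega>) {Suc j}) UNIV"
    by (rule indep_vars_restrict[OF indep]) (auto simp: disjoint_family_on_def)
  from indep_vars_compose2[OF this, of "\<lambda>j u. f (u (Suc j))" "\<lambda>_. borel"]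
  have ind: "indep_vars (\<lambda>_. borel) (\<lambda>j \<omega>. f (X (Suc j) \<omega>)) UNIV"
    by simp
  have eX: "expectation (\<lambda>\<omega>. f (X (Suc n) \<omega>)) = 0" for n
    using expectation_X[of "Suc n" f] mean by simp
  have eX2: "expectation (\<lambda>\<omega>. (f (X (Suc n) \<omega>))\<^sup>2) = \<sigma>\<^sup>2" for n
    using expectation_X[of "Suc n" "\<lambda>x. (f x)\<^sup>2"] \<sigma> by simp
  have "weak_conv_m (\<lambda>n. distr M borel (\<lambda>\<omega>. (\<Sum>i<n. f (X (Suc i) \<omega>)) / sqrt (real n * \<sigma>\<^sup>2))) std_normal_distribution"
    by (rule central_limit_theorem_zero_mean[OF ind _ \<sigma>(1), where \<mu> = "distr P borel f"])
       (use eX eX2 integrable_X[of "Suc _" "\<lambda>x. (f x)\<^sup>2"] sq distr_comp_X[of "Suc _" f] in auto)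
  \<comment> \<open>Evaluating at \<open>\<sigma> * t\<close> undoes the normalisation by
    \<sigma>.\<close>
  then have lim: "(\<lambda>n. char (distr M borel (\<lambda>\<omega>. (\<Sum>i<n. f (X (Suc i) \<omega>)) / sqrt (real n * \<sigma>\<^sup>2))) (\<sigma> * t))
      \<longlonglongrightarrow> char std_normal_distribution (\<sigma> * t)"
    by (intro levy_continuity1 real_dist_normal_dist real_distribution_distr) auto
  have eq: "char (distr M borel (\<lambda>\<omega>. (\<Sum>i<n. f (X (Suc i) \<omega>)) / sqrt (real n * \<sigma>\<^sup>2))) (\<sigma> * t)
      = char (distr P borel f) (t / sqrt (real n)) ^ n" for n
  proof -
    have "(\<Sum>i<n. f (X (Suc i) \<omega>)) / sqrt (real n * \<sigma>\<^sup>2) = inverse (sqrt (real n) * \<sigma>) * (\<Sum>i\<in>{1..n}. f (X i \<omega>))" for \<omega>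
      using \<sigma>(1) by (simp add: real_sqrt_mult divide_inverse mult.commute sum.atLeast1_atMost_eq)
    moreover have "inverse (sqrt (real n) * \<sigma>) * (\<sigma> * t) = t / sqrt (real n)"
      using \<sigma>(1) by (simp add: field_simps)
    ultimately show ?thesis
      using char_sum[of "{1..n}" "\<lambda>_. f" "inverse (sqrt (real n) * \<sigma>)" "\<sigma> * t"] by simp
  qed
  have "- (\<integral>x. (f x)\<^sup>2 \<partial>P) * t\<^sup>2 / 2 = - (\<sigma> * t)\<^sup>2 / 2" by (simp add: \<sigma> power_mult_distrib)
  with lim show ?thesis unfolding eq by (simp add: char_std_normal_distribution)
qed

end

section \<open>The risk as a function of the class means\<close>

text \<open>The density may be unbounded away from \<open>a\<close>, so \<open>r\<close> need not be Lipschitz; boundedness of \<open>r\<close>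
  still gives an error term that is quadratic far from \<open>a\<close>.\<close>

lemma first_order_expansion:
  fixes r :: "real \<Rightarrow> real"
  assumes der: "(r has_real_derivative d) (at a)" and bound: "\<And>t. \<bar>r t\<bar> \<le> 1" and \<epsilon>: "\<epsilon> > 0"
  obtains K where "K \<ge> 0" "\<And>t. \<bar>r t - r a - d * (t - a)\<bar> \<le> \<epsilon> * \<bar>t - a\<bar> + K * (t - a)\<^sup>2"
proof -
  have "(\<lambda>h. (r (a + h) - r a) / h) \<midarrow>0\<rightarrow> d"
    using der by (simp add: DERIV_def)
  from LIM_D[OF this \<epsilon>] obtain s where s: "s > 0"
    and near: "\<And>h. h \<noteq> 0 \<Longrightarrow> \<bar>h\<bar> < s \<Longrightarrow> \<bar>(r (a + h) - r a) / h - d\<bar> < \<epsilon>" by auto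
  \<comment> \<open>For \<open>\<bar>t - a\<bar> \<ge> s\<close> the increment of r, at most 2, is
    at most 2 / s times the distance to a, and the distance is at most its square divided by
    s.\<close>
  define K where "K = (2 / s + \<bar>d\<bar>) / s"
  have K: "K \<ge> 0" using s by (simp add: K_def)
  have "\<bar>r t - r a - d * (t - a)\<bar> \<le> \<epsilon> * \<bar>t - a\<bar> + K * (t - a)\<^sup>2" for t
  proof (cases "\<bar>t - a\<bar> < s")
    case True
    have "\<bar>r t - r a - d * (t - a)\<bar> \<le> \<epsilon> * \<bar>t - a\<bar>"
    proof (cases "t = a")
      case False
      then have "\<bar>r t - r a - d * (t - a)\<bar> = \<bar>(r (a + (t - a)) - r a) / (t - a) - d\<bar> * \<bar>t - a\<bar>"
        unfolding abs_mult[symmetric] left_diff_distrib[of "(r (a + (t - a)) - r a) / (t - a)"] by simp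
      also have "\<dots> \<le> \<epsilon> * \<bar>t - a\<bar>"
        using near[of "t - a"] True False by (intro mult_right_mono) auto
      finally show ?thesis .
    qed simp
    with K show ?thesis by (smt (verit) mult_nonneg_nonneg zero_le_power2)
  next
    case False
    let ?x = "\<bar>t - a\<bar>"
    have "\<bar>r t - r a - d * (t - a)\<bar> \<le> 2 + \<bar>d\<bar> * ?x"
      using bound[of t] bound[of a] by (simp add: abs_mult[symmetric])
    also have "\<dots> \<le> (2 / s + \<bar>d\<bar>) * ?x"
      using False s by (simp add: field_simps)
    also have "\<dots> \<le> (2 / s + \<bar>d\<bar>) * (?x * ?x / s)"
    proof (rule mult_left_mono)
      have "?x * s \<le> ?x * ?x" using False by (intro mult_left_mono) auto
      with s show "?x \<le> ?x * ?x / s" by (simp only: pos_le_divide_eq)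
    qed (use s in simp)
    also have "\<dots> = K * (t - a)\<^sup>2"
      by (simp add: K_def power2_eq_square)
    finally show ?thesis using \<epsilon> by (smt (verit) mult_nonneg_nonneg abs_ge_zero)
  qed
  with K that show thesis by blast
qed

text \<open>The fundamental theorem of calculus on the compact interval from t - 1 to t + 1; the
  mass to the left of it is a constant and drops out.\<close>

lemma cdf_has_real_derivative:
  assumes cont: "continuous_on UNIV g" and nonneg: "\<And>z. 0 \<le> g z" and "prob_space (law_of_density g)"
  shows "(cdf (law_of_density g) has_real_derivative g t) (at t)"
proof -
  let ?L = "law_of_density g"
  interpret L: prob_space ?L by fact
  have g [measurable]: "g \<in> borel_measurable borel"
    using cont by (rule borel_measurable_continuous_onI)
  have sets_L [measurable_cong, simp]: "sets ?L = sets borel" and space_L [simp]: "space ?L = UNIV"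
    by (auto simp: law_of_density_def)
  define a b where "a = t - 1" and "b = t + 1"
  have interval: "measure ?L {a..x} = integral {a..x} g" if "x \<in> {a..b}" for x
  proof -
    have "measure ?L {a..x} = (\<integral>z. indicator {a..x} z \<partial>?L)" by simp
    also have "\<dots> = (\<integral>z. g z * indicator {a..x} z \<partial>lborel)"
      unfolding law_of_density_def using nonneg by (subst integral_density) auto
    also have "\<dots> = (LINT z:{a..x}|lborel. g z)"
      by (simp add: set_lebesgue_integral_def mult.commute)
    also have "\<dots> = integral {a..x} g"
      by (intro set_borel_integral_eq_integral borel_integrable_atLeastAtMost' continuous_on_subset[OF cont]) auto
    finally show ?thesis .
  qed
  have eq: "cdf ?L x = measure ?L {..<a} + integral {a..x} g" if x: "x \<in> {a..b}" for x
  proof -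
    have "{..x} = {..<a} \<union> {a..x}" using x by auto
    then have "cdf ?L x = measure ?L ({..<a} \<union> {a..x})" by (simp add: cdf_def)
    also have "\<dots> = measure ?L {..<a} + measure ?L {a..x}"
      by (rule L.finite_measure_Union) auto
    finally show ?thesis using interval[OF x] by simp
  qed
  have t: "t \<in> {a<..<b}" by (simp add: a_def b_def)
  have "((\<lambda>x. measure ?L {..<a} + integral {a..x} g) has_real_derivative g t) (at t within {a..b})"
    using t DERIV_add[OF DERIV_const integral_has_real_derivative[OF continuous_on_subset[OF cont], of a b t]] by auto
  then have "(cdf ?L has_real_derivative g t) (at t within {a..b})"
    by (rule has_field_derivative_transform_within[OF _ zero_less_one]) (use t eq in auto)
  then show ?thesis
    using t by (simp add: at_within_Icc_at)
qed

section \<open>Losses of the threshold rule and of the discriminant rule with given class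
  means\<close>

definition threshold_loss :: "real \<Rightarrow> real \<times> bool \<Rightarrow> real" where
  "threshold_loss t p = of_bool (snd p \<noteq> (t < fst p))"

text \<open>The loss with the training sample replaced by its pair \<open>u\<close> of class means.
  Such a parameter can be frozen when the training fold is conditioned on.\<close>

definition mean_loss :: "real \<times> real \<Rightarrow> real \<times> bool \<Rightarrow> real" where
  "mean_loss u p = of_bool (snd p \<noteq> ((fst p - fst u)\<^sup>2 - (fst p - snd u)\<^sup>2 < 0))"

definition class_means :: "nat set \<Rightarrow> (nat \<Rightarrow> real \<times> bool) \<Rightarrow> real \<times> real" where
  "class_means T x = (mu_hat True T x, mu_hat False T x)"

lemma loss_eq_mean_loss: "loss T x p = mean_loss (class_means T x) p"
  by (simp add: loss_def classifier_def mean_loss_def class_means_def)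

text \<open>The difference of squares is affine in the test point with slope
  \<open>-2 * (a - b)\<close>, so the order of the class means decides on which side of the midpoint
  label 1 is predicted.\<close>

lemma mean_loss_eq_threshold_loss:
  assumes "a > b"
  shows "mean_loss (a, b) p = threshold_loss ((a + b) / 2) p"
proof -
  have "(fst p - a)\<^sup>2 - (fst p - b)\<^sup>2 = (a - b) * (a + b - 2 * fst p)"
    by (simp add: power2_eq_square algebra_simps)
  then have "(fst p - a)\<^sup>2 - (fst p - b)\<^sup>2 < 0 \<longleftrightarrow> (a + b) / 2 < fst p"
    using assms by (auto simp: mult_less_0_iff)
  then show ?thesis by (simp add: mean_loss_def threshold_loss_def)
qed

lemma threshold_loss_measurable [measurable]: "threshold_loss t \<in> borel_measurable obs_space"
  unfolding threshold_loss_def by measurable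

lemma mean_loss_measurable [measurable]:
  "case_prod mean_loss \<in> borel_measurable ((borel \<Otimes>\<^sub>M borel) \<Otimes>\<^sub>M obs_space)"
  unfolding mean_loss_def by measurable

lemma mean_loss_measurable_snd [measurable]: "mean_loss u \<in> borel_measurable obs_space"
  unfolding mean_loss_def by measurable

lemma mean_loss_bound: "0 \<le> mean_loss u p" "mean_loss u p \<le> 1"
  and threshold_loss_bound: "0 \<le> threshold_loss t p" "threshold_loss t p \<le> 1"
  by (auto simp: mean_loss_def threshold_loss_def)

text \<open>Classes are indexed by their label, so that statements on the class laws are proved once
  for both. The assumption \<open>mixture\<close> condenses the label probability 1/2 and the
  conditional density into one formula for integrals over a class. It speaks of \<open>X 1\<close>;
  identical distribution carries it to the other observations.\<close>

locale labelled_sample = iid_sample M X obs_space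
  for M :: "'a measure" and X :: "nat \<Rightarrow> 'a \<Rightarrow> real \<times> bool" +
  fixes g :: "bool \<Rightarrow> real \<Rightarrow> real"
  assumes continuous_g: "continuous_on UNIV (g c)" and g_nonneg: "0 \<le> g c z"
    and prob_space_L: "prob_space (law_of_density (g c))"
    and square_integrable_L: "integrable (law_of_density (g c)) (\<lambda>z. z\<^sup>2)"
    and mixture: "(\<phi> :: real \<Rightarrow> real) \<in> borel_measurable borel \<Longrightarrow> integrable (law_of_density (g c)) \<phi> \<Longrightarrow>
       has_bochner_integral M (\<lambda>\<omega>. of_bool (snd (X 1 \<omega>) = c) * \<phi> (fst (X 1 \<omega>)))
         (1/2 * (\<integral>z. \<phi> z \<partial>law_of_density (g c)))"
    and means_less: "expect (g False) (\<lambda>z. z) < expect (g True) (\<lambda>z. z)"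
begin

abbreviation L :: "bool \<Rightarrow> real measure" where "L c \<equiv> law_of_density (g c)"
abbreviation F :: "bool \<Rightarrow> real \<Rightarrow> real" where "F c \<equiv> cdf (L c)"
abbreviation m :: "bool \<Rightarrow> real" where "m c \<equiv> expect (g c) (\<lambda>z. z)"

definition \<mu> :: real where "\<mu> = (m True + m False) / 2"
definition \<Delta> :: real where "\<Delta> = g True \<mu> - g False \<mu>"
definition \<delta> :: real where "\<delta> = m True - m False"
text \<open>The misclassification probability of the threshold t: half the mass of class
  \<open>True\<close> up to t plus half the mass of class \<open>False\<close> beyond t.\<close>

definition r :: "real \<Rightarrow> real" where "r t = (F True t - F False t + 1) / 2"
definition q :: real where "q = r \<mu>"

lemma \<delta>_pos: "\<delta> > 0" using means_less by (simp add: \<delta>_def)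

lemma sets_L [measurable_cong, simp]: "sets (L c) = sets borel"
  and space_L [simp]: "space (L c) = UNIV"
  by (auto simp: law_of_density_def)

sublocale L: prob_space "L c" for c by (rule prob_space_L)

lemma integrable_id_L: "integrable (L c) (\<lambda>z. z)"
  by (rule L.square_integrable_imp_integrable[OF _ square_integrable_L]) simp

lemma expectation_L: "(\<integral>z. z \<partial>L c) = m c"
  by (simp add: expect_def)

lemma mixture_P:
  fixes f :: "real \<times> bool \<Rightarrow> real"
  assumes f [measurable]: "f \<in> borel_measurable obs_space"
    and int: "\<And>c. integrable (L c) (\<lambda>z. f (z, c))"
  shows "integrable P f" "(\<integral>p. f p \<partial>P) = ((\<integral>z. f (z, True) \<partial>L True) + (\<integral>z. f (z, False) \<partial>L False)) / 2"
proof -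
  have "has_bochner_integral M
      (\<lambda>\<omega>. of_bool (snd (X 1 \<omega>) = True) * f (fst (X 1 \<omega>), True)
          + of_bool (snd (X 1 \<omega>) = False) * f (fst (X 1 \<omega>), False))
      (1/2 * (\<integral>z. f (z, True) \<partial>L True) + 1/2 * (\<integral>z. f (z, False) \<partial>L False))"
    by (intro has_bochner_integral_add mixture[where \<phi> = "\<lambda>z. f (z, c)" and c = c for c] int) measurable
  also have "(\<lambda>\<omega>. of_bool (snd (X 1 \<omega>) = True) * f (fst (X 1 \<omega>), True)
          + of_bool (snd (X 1 \<omega>) = False) * f (fst (X 1 \<omega>), False)) = (\<lambda>\<omega>. f (X 1 \<omega>))"
  proof
    fix \<omega> show "of_bool (snd (X 1 \<omega>) = True) * f (fst (X 1 \<omega>), True)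
          + of_bool (snd (X 1 \<omega>) = False) * f (fst (X 1 \<omega>), False) = f (X 1 \<omega>)"
      by (cases "X 1 \<omega>") auto
  qed
  finally have "integrable M (\<lambda>\<omega>. f (X 1 \<omega>))"
    "expectation (\<lambda>\<omega>. f (X 1 \<omega>)) = 1/2 * (\<integral>z. f (z, True) \<partial>L True) + 1/2 * (\<integral>z. f (z, False) \<partial>L False)"
    by (auto simp: has_bochner_integral_iff)
  then show "integrable P f" "(\<integral>p. f p \<partial>P) = ((\<integral>z. f (z, True) \<partial>L True) + (\<integral>z. f (z, False) \<partial>L False)) / 2"
    by (simp_all add: integrable_X expectation_X)
qed

lemma bounded_integrable_P:
  fixes f :: "real \<times> bool \<Rightarrow> real"
  assumes "f \<in> borel_measurable obs_space" "\<And>p. \<bar>f p\<bar> \<le> C"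
  shows "integrable P f"
  by (rule P.integrable_const_bound[where B = C]) (use assms in auto)

lemma cdf_eq: "(\<integral>z. of_bool (\<not> t < z) \<partial>L c) = F c t" "(\<integral>z. of_bool (t < z) \<partial>L c) = 1 - F c t"
proof -
  have "(\<lambda>z. of_bool (\<not> t < z)) = (indicator {..t} :: real \<Rightarrow> real)"
    by (auto simp: indicator_def)
  then show 1: "(\<integral>z. of_bool (\<not> t < z) \<partial>L c) = F c t" by (simp add: cdf_def)
  have i: "integrable (L c) (\<lambda>z. of_bool (\<not> t < z) :: real)"
    by (rule L.integrable_const_bound[where B = 1]) auto
  have "(\<integral>z. of_bool (t < z) \<partial>L c) = (\<integral>z. 1 - of_bool (\<not> t < z) \<partial>L c)"
    by (rule Bochner_Integration.integral_cong) auto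
  also have "\<dots> = 1 - F c t"
    using i 1 L.prob_space[of c] by (subst Bochner_Integration.integral_diff) auto
  finally show "(\<integral>z. of_bool (t < z) \<partial>L c) = 1 - F c t" .
qed

lemma bounded_integrable_L:
  fixes f :: "real \<Rightarrow> real"
  assumes "f \<in> borel_measurable borel" "\<And>p. \<bar>f p\<bar> \<le> C"
  shows "integrable (L c) f"
  by (rule L.integrable_const_bound[where B = C]) (use assms in auto)

lemma expectation_threshold_loss: "(\<integral>p. threshold_loss t p \<partial>P) = r t"
proof -
  have "(\<integral>p. threshold_loss t p \<partial>P)
      = ((\<integral>z. threshold_loss t (z, True) \<partial>L True) + (\<integral>z. threshold_loss t (z, False) \<partial>L False)) / 2"
    by (intro mixture_P bounded_integrable_L[where C = 1]) (auto simp: abs_le_iff threshold_loss_def)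
  then show ?thesis by (simp add: threshold_loss_def cdf_eq r_def)
qed

text \<open>For ordered thresholds the indicators are nested, so the absolute value is a difference
  of fixed sign; the other order follows by symmetry.\<close>

lemma cdf_abs_diff: "(\<integral>z. \<bar>of_bool (t < z) - of_bool (s < z) :: real\<bar> \<partial>L c) = \<bar>F c t - F c s\<bar>"
proof -
  have *: "(\<integral>z. \<bar>of_bool (t < z) - of_bool (s < z) :: real\<bar> \<partial>L c) = \<bar>F c t - F c s\<bar>" if "s \<le> t" for s t
  proof -
    have i: "integrable (L c) (\<lambda>z. of_bool (a < z) :: real)" for a
      by (rule L.integrable_const_bound[where B = 1]) auto
    have "(\<integral>z. \<bar>of_bool (t < z) - of_bool (s < z) :: real\<bar> \<partial>L c) = (\<integral>z. of_bool (s < z) - of_bool (t < z) \<partial>L c)"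
      by (rule Bochner_Integration.integral_cong) (use that in auto)
    also have "\<dots> = F c t - F c s"
      using i by (subst Bochner_Integration.integral_diff) (auto simp: cdf_eq)
    also have "\<dots> = \<bar>F c t - F c s\<bar>"
    proof -
      have "F c s \<le> F c t" unfolding cdf_def by (rule L.finite_measure_mono) (use that in auto)
      then show ?thesis by simp
    qed
    finally show ?thesis .
  qed
  show ?thesis
  proof (cases "s \<le> t")
    case False
    then show ?thesis using *[of t s] by (simp add: abs_minus_commute)
  qed (rule *)
qed

text \<open>In either class two threshold rules disagree exactly between their thresholds. Since the
  c.d.f.s are differentiable, a misplaced threshold thus costs an amount linear in its
  displacement.\<close>

lemma threshold_loss_diff: "(\<integral>p. \<bar>threshold_loss t p - threshold_loss s p\<bar> \<partial>P) = (\<bar>F True t - F True s\<bar> + \<bar>F False t - F False s\<bar>) / 2"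
proof -
  have "(\<integral>p. \<bar>threshold_loss t p - threshold_loss s p\<bar> \<partial>P)
     = ((\<integral>z. \<bar>threshold_loss t (z, True) - threshold_loss s (z, True)\<bar> \<partial>L True)
       + (\<integral>z. \<bar>threshold_loss t (z, False) - threshold_loss s (z, False)\<bar> \<partial>L False)) / 2"
    by (intro mixture_P bounded_integrable_L[where C = 1]) (auto simp: abs_le_iff threshold_loss_def)
  also have "(\<integral>z. \<bar>threshold_loss t (z, True) - threshold_loss s (z, True)\<bar> \<partial>L True)
      = (\<integral>z. \<bar>of_bool (t < z) - of_bool (s < z) :: real\<bar> \<partial>L True)"
    by (rule Bochner_Integration.integral_cong) (auto simp: threshold_loss_def)
  also have "(\<integral>z. \<bar>threshold_loss t (z, False) - threshold_loss s (z, False)\<bar> \<partial>L False)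
      = (\<integral>z. \<bar>of_bool (t < z) - of_bool (s < z) :: real\<bar> \<partial>L False)"
    by (rule Bochner_Integration.integral_cong) (auto simp: threshold_loss_def)
  finally show ?thesis by (simp add: cdf_abs_diff)
qed

lemma r_derivative: "(r has_real_derivative \<Delta> / 2) (at \<mu>)"
proof -
  have F: "(F c has_real_derivative g c t) (at t)" for c t
    by (intro cdf_has_real_derivative continuous_g g_nonneg prob_space_L)
  show ?thesis unfolding r_def[abs_def] \<Delta>_def
    using DERIV_cdivide[OF DERIV_add[OF DERIV_diff[OF F[of True \<mu>] F[of False \<mu>]] DERIV_const], of 1 2] by simp
qed

lemma r_bound: "\<bar>r t\<bar> \<le> 1"
proof -
  have "0 \<le> F c t" "F c t \<le> 1" for c by (simp_all add: cdf_def)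
  from this[of True] this[of False] have "\<bar>F True t - F False t + 1\<bar> \<le> 2" unfolding abs_le_iff by linarith
  then show ?thesis by (simp add: r_def)
qed

text \<open>The risk of the trained classifier conditional on its training fold, as a function of
  the class means.\<close>

definition R :: "real \<times> real \<Rightarrow> real" where "R u = (\<integral>p. mean_loss u p \<partial>P)"

lemma R_measurable [measurable]: "R \<in> borel_measurable (borel \<Otimes>\<^sub>M borel)"
  unfolding R_def[abs_def] by (rule P.borel_measurable_lebesgue_integral) measurable

lemma integrable_mean_loss: "integrable P (mean_loss u)"
  by (rule bounded_integrable_P[where C = 1]) (use mean_loss_bound in \<open>auto simp: abs_le_iff intro: order_trans[of _ 0]\<close>)

lemma integrable_threshold_loss: "integrable P (threshold_loss t)"
  by (rule bounded_integrable_P[where C = 1]) (use threshold_loss_bound in \<open>auto simp: abs_le_iff intro: order_trans[of _ 0]\<close>)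

lemma R_bounds: "0 \<le> R u" "R u \<le> 1"
proof -
  show "0 \<le> R u" unfolding R_def by (rule Bochner_Integration.integral_nonneg) (rule mean_loss_bound)
  have "R u \<le> (\<integral>p. 1 \<partial>P)"
    unfolding R_def by (intro integral_mono integrable_mean_loss mean_loss_bound) auto
  then show "R u \<le> 1" using P.prob_space by simp
qed

lemma R_eq: "a > b \<Longrightarrow> R (a, b) = r ((a + b) / 2)"
  by (simp add: R_def mean_loss_eq_threshold_loss expectation_threshold_loss)

definition dev :: "real \<times> real \<Rightarrow> real" where "dev u = (fst u + snd u) / 2 - \<mu>"
text \<open>Class means in the wrong order force \<open>\<bar>gap u\<bar> \<ge> \<delta>\<close>, so this event is controlled by the second
  moment of \<open>gap\<close>.\<close>

definition gap :: "real \<times> real \<Rightarrow> real" where "gap u = fst u - snd u - \<delta>"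

lemma wrong_order: "\<not> fst u > snd u \<Longrightarrow> 1 \<le> (gap u)\<^sup>2 / \<delta>\<^sup>2"
proof -
  assume "\<not> fst u > snd u"
  then have "gap u \<le> - \<delta>" by (simp add: gap_def)
  then have "\<delta>\<^sup>2 \<le> (gap u)\<^sup>2" using \<delta>_pos by (intro abs_le_square_iff[THEN iffD1]) auto
  then show ?thesis using \<delta>_pos by simp
qed

text \<open>With the class means in the right order this is the expansion of \<open>r\<close> at
  their midpoint. In the wrong order only boundedness is at hand, and
  \<open>(gap u)\<^sup>2 / \<delta>\<^sup>2\<close>, which is then at least 1, pays for it.\<close>

lemma R_expansion:
  assumes "\<epsilon> > 0"
  obtains K where "K \<ge> 0" "\<And>u. \<bar>R u - q - \<Delta> / 2 * dev u\<bar> \<le> \<epsilon> * \<bar>dev u\<bar> + K * ((dev u)\<^sup>2 + (gap u)\<^sup>2)"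
proof -
  obtain K where K: "K \<ge> 0" "\<And>t. \<bar>r t - r \<mu> - \<Delta> / 2 * (t - \<mu>)\<bar> \<le> \<epsilon> * \<bar>t - \<mu>\<bar> + K * (t - \<mu>)\<^sup>2"
    using first_order_expansion[OF r_derivative r_bound assms] by blast
  \<comment> \<open>\<open>R\<close> lies between 0 and 1 and \<bar>r\<bar> is at most 1, so the two
    differ by at most 2; this is the numerator of the second summand.\<close>
  define K' where "K' = K + 2 / \<delta>\<^sup>2"
  have K': "K' \<ge> K" "K' \<ge> 2 / \<delta>\<^sup>2" using K by (auto simp: K'_def)
  show thesis
  proof
    show "K' \<ge> 0" using K K' by linarith
    fix u :: "real \<times> real"
    let ?t = "(fst u + snd u) / 2"
    have d: "?t - \<mu> = dev u" by (simp add: dev_def)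
    have "\<bar>R u - r ?t\<bar> \<le> 2 / \<delta>\<^sup>2 * (gap u)\<^sup>2"
    proof (cases "fst u > snd u")
      case True
      then show ?thesis using R_eq[of "snd u" "fst u"] by simp
    next
      case False
      have "\<bar>R u - r ?t\<bar> \<le> 2" using R_bounds[of u] r_bound[of ?t] by linarith
      with wrong_order[OF False] show ?thesis by simp
    qed
    also have "\<dots> \<le> K' * (gap u)\<^sup>2" by (intro mult_right_mono K') auto
    finally have "\<bar>R u - r ?t\<bar> \<le> K' * (gap u)\<^sup>2" .
    moreover have "K * (dev u)\<^sup>2 \<le> K' * (dev u)\<^sup>2" by (intro mult_right_mono K') auto
    moreover have "\<bar>r ?t - q - \<Delta> / 2 * dev u\<bar> \<le> \<epsilon> * \<bar>dev u\<bar> + K * (dev u)\<^sup>2"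
      using K(2)[of ?t] unfolding d q_def .
    ultimately show "\<bar>R u - q - \<Delta> / 2 * dev u\<bar> \<le> \<epsilon> * \<bar>dev u\<bar> + K' * ((dev u)\<^sup>2 + (gap u)\<^sup>2)"
      unfolding distrib_left by linarith
  qed
qed

definition centred_diff :: "real \<times> real \<Rightarrow> real \<times> bool \<Rightarrow> real" where
  "centred_diff u p = (mean_loss u p - R u) - (threshold_loss \<mu> p - q)"

lemma centred_diff_measurable [measurable]:
  "case_prod centred_diff \<in> borel_measurable ((borel \<Otimes>\<^sub>M borel) \<Otimes>\<^sub>M obs_space)"
proof -
  have [measurable]: "(\<lambda>x. mean_loss (fst x) (snd x)) \<in> borel_measurable ((borel \<Otimes>\<^sub>M borel) \<Otimes>\<^sub>M obs_space)"
    using mean_loss_measurable by (simp add: case_prod_beta')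
  show ?thesis unfolding centred_diff_def case_prod_beta' by measurable
qed

lemma centred_diff_mean: "(\<integral>p. centred_diff u p \<partial>P) = 0"
  unfolding centred_diff_def using P.prob_space
  by (simp add: integrable_mean_loss integrable_threshold_loss expectation_threshold_loss R_def[symmetric] q_def)

lemma centred_diff_bound: "\<bar>centred_diff u p\<bar> \<le> 4"
  using mean_loss_bound[of u p] threshold_loss_bound[of \<mu> p] R_bounds[of u] r_bound[of \<mu>]
  unfolding centred_diff_def q_def by linarith

text \<open>Near the limit the test noise is the disagreement of two nearby threshold rules, whose
  probability is a sum of c.d.f. increments. This accounts for the term linear in \<bar>dev u\<bar>;
  the squares cover displacements that are large and class means in the wrong order.\<close>

lemma centred_diff_square:
  obtains K where "K \<ge> 0"
    "\<And>u. (\<integral>p. (centred_diff u p)\<^sup>2 \<partial>P) \<le> K * (\<bar>dev u\<bar> + (dev u)\<^sup>2 + (gap u)\<^sup>2)"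
proof -
  have F: "(F c has_real_derivative g c t) (at t)" for c t
    by (intro cdf_has_real_derivative continuous_g g_nonneg prob_space_L)
  have Fb: "\<bar>F c t\<bar> \<le> 1" for c t using L.prob_le_1[of c "{..t}"] by (simp add: cdf_def)
  have "\<exists>K\<ge>0. \<forall>t. \<bar>F c t - F c \<mu>\<bar> \<le> K * \<bar>t - \<mu>\<bar> + K * (t - \<mu>)\<^sup>2" for c
  proof -
    obtain K where K: "K \<ge> 0" "\<And>t. \<bar>F c t - F c \<mu> - g c \<mu> * (t - \<mu>)\<bar> \<le> 1 * \<bar>t - \<mu>\<bar> + K * (t - \<mu>)\<^sup>2"
      using first_order_expansion[OF F Fb zero_less_one] by blast
    \<comment> \<open>The 1 is the \<epsilon> chosen in the expansion and \<open>g c \<mu>\<close>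
      is the derivative; a single constant serves both powers.\<close>
    define K' where "K' = 1 + g c \<mu> + K"
    have g0: "g c \<mu> \<ge> 0" by (rule g_nonneg)
    have "\<bar>F c t - F c \<mu>\<bar> \<le> K' * \<bar>t - \<mu>\<bar> + K' * (t - \<mu>)\<^sup>2" for t
    proof -
      have "\<bar>F c t - F c \<mu>\<bar> \<le> \<bar>F c t - F c \<mu> - g c \<mu> * (t - \<mu>)\<bar> + \<bar>g c \<mu> * (t - \<mu>)\<bar>" by linarith
      also have "\<dots> \<le> (1 + g c \<mu>) * \<bar>t - \<mu>\<bar> + K * (t - \<mu>)\<^sup>2"
        using K(2)[of t] g0 by (simp add: abs_mult distrib_right)
      also have "\<dots> \<le> K' * \<bar>t - \<mu>\<bar> + K' * (t - \<mu>)\<^sup>2"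
        using K(1) g0 by (intro add_mono mult_right_mono) (auto simp: K'_def)
      finally show ?thesis .
    qed
    moreover have "K' \<ge> 0" using K g0 by (simp add: K'_def)
    ultimately show ?thesis by blast
  qed
  then obtain KF where KF: "\<And>c. KF c \<ge> 0" "\<And>c t. \<bar>F c t - F c \<mu>\<bar> \<le> KF c * \<bar>t - \<mu>\<bar> + KF c * (t - \<mu>)\<^sup>2"
    by metis
  define K where "K = KF True + KF False + 1 / \<delta>\<^sup>2"
  have K: "K \<ge> KF True + KF False" "K \<ge> 1 / \<delta>\<^sup>2" "K \<ge> 0"
    using KF(1)[of True] KF(1)[of False] by (auto simp: K_def)
  show thesis
  proof
    show "K \<ge> 0" by (rule K)
    fix u :: "real \<times> real"
    let ?t = "(fst u + snd u) / 2"
    let ?D = "\<lambda>p. mean_loss u p - threshold_loss \<mu> p"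
    have d: "?t - \<mu> = dev u" by (simp add: dev_def)
    \<comment> \<open>Two 0-1 losses differ by -1, 0 or 1, which turns the second moment into a
      probability of disagreement.\<close>
    have Dsq: "(?D p)\<^sup>2 = \<bar>?D p\<bar>" for p by (auto simp: mean_loss_def threshold_loss_def)
    have iD: "integrable P ?D" by (intro Bochner_Integration.integrable_diff integrable_mean_loss integrable_threshold_loss)
    have mD: "(\<integral>p. ?D p \<partial>P) = R u - q"
      using integrable_mean_loss integrable_threshold_loss
      by (simp add: R_def q_def expectation_threshold_loss)
    have iD2: "integrable P (\<lambda>p. (?D p)\<^sup>2)" unfolding Dsq using iD by simp
    \<comment> \<open>\<open>centred_diff u\<close> is \<open>?D\<close> minus its mean, so its
      second moment is a variance and is at most the raw second moment of \<open>?D\<close>.\<close>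
    have "(\<integral>p. (centred_diff u p)\<^sup>2 \<partial>P) = P.variance ?D"
      unfolding mD centred_diff_def by (intro Bochner_Integration.integral_cong refl arg_cong[where f = "\<lambda>x. x\<^sup>2"]) simp
    also have "\<dots> \<le> (\<integral>p. (?D p)\<^sup>2 \<partial>P)"
      by (subst P.variance_eq[OF iD iD2]) simp
    also have "\<dots> = (\<integral>p. \<bar>?D p\<bar> \<partial>P)" unfolding Dsq ..
    also have "\<dots> \<le> K * (\<bar>dev u\<bar> + (dev u)\<^sup>2 + (gap u)\<^sup>2)"
    proof (cases "fst u > snd u")
      case True
      have "(\<integral>p. \<bar>?D p\<bar> \<partial>P) = (\<bar>F True ?t - F True \<mu>\<bar> + \<bar>F False ?t - F False \<mu>\<bar>) / 2"
        using mean_loss_eq_threshold_loss[OF True] by (simp add: threshold_loss_diff)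
      also have "\<dots> \<le> \<bar>F True ?t - F True \<mu>\<bar> + \<bar>F False ?t - F False \<mu>\<bar>" by simp
      also have "\<dots> \<le> (KF True + KF False) * (\<bar>dev u\<bar> + (dev u)\<^sup>2)"
        using KF(2)[of True ?t] KF(2)[of False ?t] unfolding d by (simp add: algebra_simps)
      also have "\<dots> \<le> K * (\<bar>dev u\<bar> + (dev u)\<^sup>2 + (gap u)\<^sup>2)"
        using K by (intro mult_mono) auto
      finally show ?thesis .
    next
      case False
      have "(\<integral>p. \<bar>?D p\<bar> \<partial>P) \<le> (\<integral>p. 1 \<partial>P)"
        using iD by (intro integral_mono) (auto simp: mean_loss_def threshold_loss_def)
      also have "\<dots> \<le> 1 / \<delta>\<^sup>2 * (gap u)\<^sup>2" using wrong_order[OF False] P.prob_space by simp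
      also have "\<dots> \<le> K * (\<bar>dev u\<bar> + (dev u)\<^sup>2 + (gap u)\<^sup>2)"
        using K by (intro mult_mono) auto
      finally show ?thesis .
    qed
    finally show "(\<integral>p. (centred_diff u p)\<^sup>2 \<partial>P) \<le> K * (\<bar>dev u\<bar> + (dev u)\<^sup>2 + (gap u)\<^sup>2)" .
  qed
qed

end

section \<open>Linearisation of the empirical risks\<close>

text \<open>The variance of \<bar>f\<bar> is nonnegative; equivalently, the Cauchy-Schwarz
  inequality against the constant 1.\<close>

lemma (in prob_space) expectation_abs_le_sqrt:
  fixes f :: "'a \<Rightarrow> real"
  assumes [measurable]: "f \<in> borel_measurable M" and sq: "integrable M (\<lambda>x. (f x)\<^sup>2)"
  shows "integrable M (\<lambda>x. \<bar>f x\<bar>)" "expectation (\<lambda>x. \<bar>f x\<bar>) \<le> sqrt (expectation (\<lambda>x. (f x)\<^sup>2))"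
proof -
  show int: "integrable M (\<lambda>x. \<bar>f x\<bar>)"
    using square_integrable_imp_integrable[OF _ sq] by simp
  have "0 \<le> expectation (\<lambda>x. \<bar>f x\<bar>\<^sup>2) - (expectation (\<lambda>x. \<bar>f x\<bar>))\<^sup>2"
    using variance_positive[of "\<lambda>x. \<bar>f x\<bar>"] variance_eq[of "\<lambda>x. \<bar>f x\<bar>"] int sq by simp
  then show "expectation (\<lambda>x. \<bar>f x\<bar>) \<le> sqrt (expectation (\<lambda>x. (f x)\<^sup>2))"
    by (intro real_le_rsqrt) simp
qed

context labelled_sample
begin

definition centred_obs :: "real \<times> bool \<Rightarrow> real" where "centred_obs p = fst p - \<mu>"
text \<open>The factor 2 undoes the label probability 1/2, so that the signed observation has mean
  \<delta>.\<close>

definition centred_contrast :: "real \<times> bool \<Rightarrow> real" where "centred_contrast p = 2 * fst p * (if snd p then 1 else - 1) - \<delta>"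

lemma centred_obs_measurable [measurable]: "centred_obs \<in> borel_measurable obs_space"
  and centred_contrast_measurable [measurable]: "centred_contrast \<in> borel_measurable obs_space"
  unfolding centred_obs_def centred_contrast_def by measurable

lemma affine_L:
  "integrable (L c) (\<lambda>z. a * z + b)" "(\<integral>z. a * z + b \<partial>L c) = a * m c + b"
  "integrable (L c) (\<lambda>z. (a * z + b)\<^sup>2)"
proof -
  show "integrable (L c) (\<lambda>z. a * z + b)" "(\<integral>z. a * z + b \<partial>L c) = a * m c + b"
    using L.prob_space[of c] by (simp_all add: integrable_id_L expectation_L)
  have "integrable (L c) (\<lambda>z. a\<^sup>2 * z\<^sup>2 + (2 * a * b) * z + b\<^sup>2)"
    by (intro Bochner_Integration.integrable_add Bochner_Integration.integrable_mult_right
        square_integrable_L integrable_id_L) auto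
  then show "integrable (L c) (\<lambda>z. (a * z + b)\<^sup>2)"
    by (rule Bochner_Integration.integrable_cong[THEN iffD1, rotated 2])
       (auto simp: power2_eq_square algebra_simps)
qed

lemma centred_obs_moments: "(\<integral>p. centred_obs p \<partial>P) = 0" "integrable P (\<lambda>p. (centred_obs p)\<^sup>2)"
proof -
  have "(\<integral>p. centred_obs p \<partial>P) = ((\<integral>z. centred_obs (z, True) \<partial>L True) + (\<integral>z. centred_obs (z, False) \<partial>L False)) / 2"
    using affine_L(1)[where a = 1 and b = "- \<mu>"] by (intro mixture_P) (auto simp: centred_obs_def)
  also have "\<dots> = ((m True - \<mu>) + (m False - \<mu>)) / 2"
    using affine_L(2)[where a = 1 and b = "- \<mu>"] by (simp add: centred_obs_def)
  also have "\<dots> = 0" by (simp add: \<mu>_def field_simps)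
  finally show "(\<integral>p. centred_obs p \<partial>P) = 0" .
  show "integrable P (\<lambda>p. (centred_obs p)\<^sup>2)"
    using affine_L(3)[where a = 1 and b = "- \<mu>"] by (intro mixture_P) (auto simp: centred_obs_def)
qed

lemma centred_contrast_moments: "(\<integral>p. centred_contrast p \<partial>P) = 0" "integrable P (\<lambda>p. (centred_contrast p)\<^sup>2)"
proof -
  have eq: "centred_contrast (z, c) = (if c then 2 else - 2) * z + (- \<delta>)" for z c by (simp add: centred_contrast_def)
  have "(\<integral>p. centred_contrast p \<partial>P) = ((\<integral>z. centred_contrast (z, True) \<partial>L True) + (\<integral>z. centred_contrast (z, False) \<partial>L False)) / 2"
    by (intro mixture_P) (simp_all only: centred_contrast_measurable eq affine_L)
  also have "\<dots> = ((2 * m True - \<delta>) + (- 2 * m False - \<delta>)) / 2"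
    by (simp only: eq affine_L) simp
  also have "\<dots> = 0" by (simp add: \<delta>_def field_simps)
  finally show "(\<integral>p. centred_contrast p \<partial>P) = 0" .
  show "integrable P (\<lambda>p. (centred_contrast p)\<^sup>2)"
    by (intro mixture_P) (simp_all only: eq affine_L, measurable)
qed

definition obs_variance :: real where "obs_variance = (\<integral>p. (centred_obs p)\<^sup>2 \<partial>P)"
definition contrast_variance :: real where "contrast_variance = (\<integral>p. (centred_contrast p)\<^sup>2 \<partial>P)"

lemma variances_nonneg: "obs_variance \<ge> 0" "contrast_variance \<ge> 0" by (simp_all add: obs_variance_def contrast_variance_def)

text \<open>Adding the two class sums removes the labels, and the 2 of their normalisation cancels
  against the 1/2 of the midpoint. A plain average remains, with no random class size in a
  denominator.\<close>

lemma dev_eq: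
  assumes "card T \<noteq> 0"
  shows "dev (class_means T x) = (\<Sum>i\<in>T. centred_obs (x i)) / real (card T)"
proof -
  have "fst (class_means T x) + snd (class_means T x)
     = 2 / real (card T) * (\<Sum>i\<in>T. fst (x i) * of_bool (snd (x i) = True) + fst (x i) * of_bool (snd (x i) = False))"
    by (simp add: class_means_def mu_hat_def sum.distrib distrib_left)
  also have "(\<Sum>i\<in>T. fst (x i) * of_bool (snd (x i) = True) + fst (x i) * of_bool (snd (x i) = False)) = (\<Sum>i\<in>T. fst (x i))"
    by (rule sum.cong) auto
  finally have "fst (class_means T x) + snd (class_means T x) = 2 / real (card T) * (\<Sum>i\<in>T. fst (x i))" .
  then show ?thesis using assms
    by (simp add: dev_def centred_obs_def sum_subtractf diff_divide_distrib)
qed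

lemma gap_eq:
  assumes "card T \<noteq> 0"
  shows "gap (class_means T x) = (\<Sum>i\<in>T. centred_contrast (x i)) / real (card T)"
proof -
  have "fst (class_means T x) - snd (class_means T x)
     = 2 / real (card T) * (\<Sum>i\<in>T. fst (x i) * of_bool (snd (x i) = True) - fst (x i) * of_bool (snd (x i) = False))"
    by (simp add: class_means_def mu_hat_def sum_subtractf right_diff_distrib)
  also have "(\<Sum>i\<in>T. fst (x i) * of_bool (snd (x i) = True) - fst (x i) * of_bool (snd (x i) = False))
      = (\<Sum>i\<in>T. fst (x i) * (if snd (x i) then 1 else - 1))"
    by (rule sum.cong) auto
  also have "2 / real (card T) * \<dots> = (\<Sum>i\<in>T. 2 * fst (x i) * (if snd (x i) then 1 else - 1)) / real (card T)"
    by (simp add: sum_distrib_left sum_divide_distrib mult.assoc)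
  finally show ?thesis using assms
    by (simp add: gap_def centred_contrast_def sum_subtractf diff_divide_distrib)
qed

lemma class_means_restrict: "class_means T (restrict x T) = class_means T x"
  by (simp add: class_means_def mu_hat_def)

lemma class_means_measurable [measurable]:
  "class_means T \<in> measurable (PiM T (\<lambda>_. obs_space)) (borel \<Otimes>\<^sub>M borel)"
  unfolding class_means_def[abs_def] mu_hat_def by measurable

definition \<xi> :: "nat set \<Rightarrow> 'a \<Rightarrow> real \<times> real" where
  "\<xi> T \<omega> = class_means T (\<lambda>i. X i \<omega>)"

text \<open>Exhibits the class means as a function of the block \<open>T\<close>, the form in which
  \<open>sum_conditional_square\<close> accepts a statistic.\<close>

lemma \<xi>_restrict: "\<xi> T = (\<lambda>\<omega>. class_means T (restrict (\<lambda>i. X i \<omega>) T))"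
  by (simp add: \<xi>_def class_means_restrict fun_eq_iff)

lemma \<xi>_measurable: "T \<subseteq> {1..} \<Longrightarrow> \<xi> T \<in> measurable M (borel \<Otimes>\<^sub>M borel)"
  unfolding \<xi>_restrict
  by (intro measurable_compose[OF measurable_restrict class_means_measurable] X_measurable) auto

lemma dev_measurable [measurable]: "dev \<in> borel_measurable (borel \<Otimes>\<^sub>M borel)"
  and gap_measurable [measurable]: "gap \<in> borel_measurable (borel \<Otimes>\<^sub>M borel)"
  unfolding dev_def[abs_def] gap_def[abs_def] by measurable

lemma dev_moments:
  assumes T: "T \<subseteq> {1..}" "card T = k" "k \<ge> 1"
  shows "integrable M (\<lambda>\<omega>. (dev (\<xi> T \<omega>))\<^sup>2)" "expectation (\<lambda>\<omega>. (dev (\<xi> T \<omega>))\<^sup>2) = obs_variance / k"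
    "integrable M (\<lambda>\<omega>. dev (\<xi> T \<omega>))" "expectation (\<lambda>\<omega>. dev (\<xi> T \<omega>)) = 0"
    "expectation (\<lambda>\<omega>. \<bar>dev (\<xi> T \<omega>)\<bar>) \<le> sqrt (obs_variance / k)"
proof -
  have fin: "finite T" using T by (metis card.infinite not_one_le_zero)
  note [measurable] = \<xi>_measurable[OF T(1)]
  have eq: "dev (\<xi> T \<omega>) = (\<Sum>i\<in>T. centred_obs (X i \<omega>)) / real k" for \<omega>
    using T by (simp add: \<xi>_def dev_eq)
  have sq: "(dev (\<xi> T \<omega>))\<^sup>2 = (\<Sum>i\<in>T. centred_obs (X i \<omega>))\<^sup>2 / (real k)\<^sup>2" for \<omega>
    unfolding eq by (simp add: power_divide)
  show i: "integrable M (\<lambda>\<omega>. (dev (\<xi> T \<omega>))\<^sup>2)"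
    unfolding sq by (intro Bochner_Integration.integrable_divide sum_iid_square[OF fin T(1)] centred_obs_moments centred_obs_measurable)
  have "expectation (\<lambda>\<omega>. (dev (\<xi> T \<omega>))\<^sup>2) = (real (card T) * obs_variance) / (real k)\<^sup>2"
    unfolding sq obs_variance_def using sum_iid_square(2)[OF fin T(1) centred_obs_measurable centred_obs_moments(2,1)] by simp
  then show e: "expectation (\<lambda>\<omega>. (dev (\<xi> T \<omega>))\<^sup>2) = obs_variance / k"
    using T by (simp add: power2_eq_square)
  show "integrable M (\<lambda>\<omega>. dev (\<xi> T \<omega>))"
    by (rule square_integrable_imp_integrable[OF _ i]) measurable
  have "expectation (\<lambda>\<omega>. centred_obs (X i \<omega>)) = 0" "integrable M (\<lambda>\<omega>. centred_obs (X i \<omega>))" if "i \<in> T" for i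
    using that T centred_obs_moments P.square_integrable_imp_integrable[OF _ centred_obs_moments(2)]
    by (auto simp: expectation_X integrable_X)
  then show "expectation (\<lambda>\<omega>. dev (\<xi> T \<omega>)) = 0"
    unfolding eq by (simp add: Bochner_Integration.integral_sum)
  show "expectation (\<lambda>\<omega>. \<bar>dev (\<xi> T \<omega>)\<bar>) \<le> sqrt (obs_variance / k)"
    using expectation_abs_le_sqrt(2)[OF _ i] unfolding e by measurable
qed

lemma gap_moments:
  assumes T: "T \<subseteq> {1..}" "card T = k" "k \<ge> 1"
  shows "integrable M (\<lambda>\<omega>. (gap (\<xi> T \<omega>))\<^sup>2)" "expectation (\<lambda>\<omega>. (gap (\<xi> T \<omega>))\<^sup>2) = contrast_variance / k"
proof -
  have fin: "finite T" using T by (metis card.infinite not_one_le_zero)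
  have sq: "(gap (\<xi> T \<omega>))\<^sup>2 = (\<Sum>i\<in>T. centred_contrast (X i \<omega>))\<^sup>2 / (real k)\<^sup>2" for \<omega>
    using T by (simp add: \<xi>_def gap_eq power_divide)
  show "integrable M (\<lambda>\<omega>. (gap (\<xi> T \<omega>))\<^sup>2)"
    unfolding sq by (intro Bochner_Integration.integrable_divide sum_iid_square[OF fin T(1)] centred_contrast_moments centred_contrast_measurable)
  have "expectation (\<lambda>\<omega>. (gap (\<xi> T \<omega>))\<^sup>2) = (real (card T) * contrast_variance) / (real k)\<^sup>2"
    unfolding sq contrast_variance_def using sum_iid_square(2)[OF fin T(1) centred_contrast_measurable centred_contrast_moments(2,1)] by simp
  then show "expectation (\<lambda>\<omega>. (gap (\<xi> T \<omega>))\<^sup>2) = contrast_variance / k"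
    using T by (simp add: power2_eq_square)
qed

definition remainder :: "real \<times> real \<Rightarrow> real" where
  "remainder u = R u - q - \<Delta> / 2 * dev u"

lemma remainder_integrable:
  assumes T: "T \<subseteq> {1..}" "card T = k" "k \<ge> 1"
  shows "integrable M (\<lambda>\<omega>. remainder (\<xi> T \<omega>))" "integrable M (\<lambda>\<omega>. R (\<xi> T \<omega>))"
proof -
  note [measurable] = \<xi>_measurable[OF T(1)]
  show R: "integrable M (\<lambda>\<omega>. R (\<xi> T \<omega>))"
    by (rule integrable_const_bound[where B = 1]) (use R_bounds in \<open>auto simp: abs_le_iff intro: order_trans[of _ 0]\<close>)
  then show "integrable M (\<lambda>\<omega>. remainder (\<xi> T \<omega>))"
    unfolding remainder_def using dev_moments(3)[OF T]
    by (intro Bochner_Integration.integrable_diff Bochner_Integration.integrable_mult_right) auto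
qed

text \<open>In L1, \<open>dev\<close> is of order k^(-1/2), while the squares of \<open>dev\<close>
  and \<open>gap\<close> are of order 1/k. Multiplied by sqrt k, the linear error leaves e times a
  standard deviation and the quadratic error vanishes. The bound is uniform over all
  \<open>T\<close> of size k because the folds are arbitrary and may change with n.\<close>

lemma remainder_small:
  assumes "\<epsilon> > 0"
  shows "\<forall>\<^sub>F k in sequentially. \<forall>T. T \<subseteq> {1..} \<longrightarrow> card T = k \<longrightarrow>
     sqrt (real k) * expectation (\<lambda>\<omega>. \<bar>remainder (\<xi> T \<omega>)\<bar>) \<le> \<epsilon>"
proof -
  \<comment> \<open>The added 1 keeps c positive, so that e makes sense when the variance is 0, and
    \<open>e * sqrt obs_variance\<close> stays below \<epsilon>.\<close>
  define c where "c = sqrt obs_variance + 1"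
  define e where "e = \<epsilon> / (2 * c)"
  have c: "c > 0" unfolding c_def by (rule add_nonneg_pos) (use variances_nonneg in auto)
  with assms have e: "e > 0" unfolding e_def by (intro divide_pos_pos mult_pos_pos) auto
  obtain K where K: "K \<ge> 0" "\<And>u. \<bar>remainder u\<bar> \<le> e * \<bar>dev u\<bar> + K * ((dev u)\<^sup>2 + (gap u)\<^sup>2)"
    unfolding remainder_def using R_expansion[OF e] by blast
  have "e * c = \<epsilon> / 2" using c by (simp add: e_def)
  then have "e * sqrt obs_variance = \<epsilon> / 2 - e" by (simp add: c_def distrib_left)
  also have "\<dots> < \<epsilon>" using e assms by linarith
  finally have less: "e * sqrt obs_variance < \<epsilon>" .
  have "(\<lambda>k. e * sqrt obs_variance + K * (obs_variance + contrast_variance) / sqrt (real k)) \<longlonglongrightarrow> e * sqrt obs_variance + 0"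
    by (intro tendsto_intros tendsto_divide_0[OF tendsto_const]
        filterlim_at_top_imp_at_infinity filterlim_compose[OF sqrt_at_top filterlim_real_sequentially])
  then have "\<forall>\<^sub>F k in sequentially. e * sqrt obs_variance + K * (obs_variance + contrast_variance) / sqrt (real k) < \<epsilon>"
    using less by (intro order_tendstoD) auto
  then show ?thesis
    using eventually_ge_at_top[of 1]
  proof eventually_elim
    case (elim k)
    show ?case
    proof (intro allI impI)
      fix T :: "nat set" assume T: "T \<subseteq> {1..}" "card T = k"
      note T' = T elim(2)
      have i: "integrable M (\<lambda>\<omega>. \<bar>dev (\<xi> T \<omega>)\<bar>)" using dev_moments(3)[OF T'] by simp
      have "expectation (\<lambda>\<omega>. \<bar>remainder (\<xi> T \<omega>)\<bar>)
          \<le> expectation (\<lambda>\<omega>. e * \<bar>dev (\<xi> T \<omega>)\<bar> + K * ((dev (\<xi> T \<omega>))\<^sup>2 + (gap (\<xi> T \<omega>))\<^sup>2))"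
        using i dev_moments(1)[OF T'] gap_moments(1)[OF T'] remainder_integrable(1)[OF T']
        by (intro integral_mono K) auto
      also have "\<dots> = e * expectation (\<lambda>\<omega>. \<bar>dev (\<xi> T \<omega>)\<bar>) + K * (obs_variance / k + contrast_variance / k)"
        using i dev_moments(1,2)[OF T'] gap_moments[OF T'] by simp
      also have "\<dots> \<le> e * sqrt (obs_variance / k) + K * (obs_variance / k + contrast_variance / k)"
        using dev_moments(5)[OF T'] e by simp
      finally have "sqrt (real k) * expectation (\<lambda>\<omega>. \<bar>remainder (\<xi> T \<omega>)\<bar>)
          \<le> sqrt (real k) * (e * sqrt (obs_variance / k) + K * (obs_variance / k + contrast_variance / k))"
        by (intro mult_left_mono) auto
      also have "\<dots> = e * sqrt obs_variance + K * (obs_variance + contrast_variance) * (sqrt (real k) / real k)"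
        using elim(2) by (simp add: real_sqrt_divide field_simps)
      also have "sqrt (real k) / real k = 1 / sqrt (real k)"
        using elim(2) by (simp add: real_div_sqrt field_simps)
      finally show "sqrt (real k) * expectation (\<lambda>\<omega>. \<bar>remainder (\<xi> T \<omega>)\<bar>) \<le> \<epsilon>"
        using elim(1) by simp
    qed
  qed
qed

text \<open>By Fubini the new observation is integrated out first, which leaves the conditional
  risk.\<close>

lemma mean_risk_eq: "mean_risk M X k = expectation (\<lambda>\<omega>. R (\<xi> {1..k} \<omega>))"
proof -
  have [measurable]: "\<xi> {1..k} \<in> measurable M (borel \<Otimes>\<^sub>M borel)" by (rule \<xi>_measurable) auto
  have [measurable]: "(\<lambda>x. mean_loss (fst x) (snd x)) \<in> borel_measurable ((borel \<Otimes>\<^sub>M borel) \<Otimes>\<^sub>M obs_space)"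
    using mean_loss_measurable by (simp add: case_prod_beta')
  interpret MP: pair_prob_space M P ..
  have "mean_risk M X k = (\<integral>x. mean_loss (\<xi> {1..k} (fst x)) (snd x) \<partial>(M \<Otimes>\<^sub>M P))"
    by (simp add: mean_risk_def loss_eq_mean_loss \<xi>_def P_def case_prod_beta')
  also have "\<dots> = (\<integral>\<omega>. \<integral>p. mean_loss (\<xi> {1..k} (fst (\<omega>, p))) (snd (\<omega>, p)) \<partial>P \<partial>M)"
  proof (rule MP.integral_fst'[symmetric], rule MP.integrable_const_bound[where B = 1, OF AE_I2])
    show "norm (mean_loss (\<xi> {1..k} (fst x)) (snd x)) \<le> 1" for x
      using mean_loss_bound[of "\<xi> {1..k} (fst x)" "snd x"] by simp
    have "(\<lambda>x. (\<lambda>x. mean_loss (fst x) (snd x)) (\<xi> {1..k} (fst x), snd x)) \<in> borel_measurable (M \<Otimes>\<^sub>M P)"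
      by measurable
    then show "(\<lambda>x. mean_loss (\<xi> {1..k} (fst x)) (snd x)) \<in> borel_measurable (M \<Otimes>\<^sub>M P)" by simp
  qed
  finally show ?thesis by (simp add: R_def)
qed

text \<open>The linear term of the risk averages to zero because \<open>dev\<close> is centred.
  Centring at the mean risk instead of \<open>q\<close> therefore costs only the expected
  remainder.\<close>

lemma mean_risk_diff:
  assumes "k \<ge> 1"
  shows "mean_risk M X k - q = expectation (\<lambda>\<omega>. remainder (\<xi> {1..k} \<omega>))"
proof -
  have T: "{1..k} \<subseteq> {1..}" "card {1..k} = k" by auto
  show ?thesis
    unfolding remainder_def mean_risk_eq
    using dev_moments(3,4)[OF T assms] remainder_integrable(2)[OF T assms] prob_space by simp
qed

section \<open>Linear parts of the risk, and the error that one fold leaves\<close>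

definition U :: "real \<times> bool \<Rightarrow> real" where "U p = threshold_loss \<mu> p - q"
definition V :: "real \<times> bool \<Rightarrow> real" where "V p = \<Delta> / 2 * centred_obs p"

lemma U_measurable [measurable]: "U \<in> borel_measurable obs_space"
  and V_measurable [measurable]: "V \<in> borel_measurable obs_space"
  unfolding U_def[abs_def] V_def[abs_def] by measurable

lemma U_moments: "(\<integral>p. U p \<partial>P) = 0" "integrable P (\<lambda>p. (U p)\<^sup>2)" "(\<integral>p. (U p)\<^sup>2 \<partial>P) = q * (1 - q)"
proof -
  show U0: "(\<integral>p. U p \<partial>P) = 0"
    unfolding U_def using P.prob_space
    by (simp add: integrable_threshold_loss expectation_threshold_loss q_def)
  \<comment> \<open>The loss takes the values 0 and 1, so it equals its square and the square of
    \<open>U\<close> is affine in it.\<close>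
  have sq: "(U p)\<^sup>2 = (1 - 2 * q) * threshold_loss \<mu> p + q\<^sup>2" for p
    by (auto simp: U_def threshold_loss_def power2_eq_square algebra_simps)
  show "integrable P (\<lambda>p. (U p)\<^sup>2)"
    unfolding sq by (intro Bochner_Integration.integrable_add Bochner_Integration.integrable_mult_right
        integrable_threshold_loss) auto
  have "(\<integral>p. (U p)\<^sup>2 \<partial>P) = (1 - 2 * q) * q + q\<^sup>2"
    unfolding sq using P.prob_space
    by (simp add: integrable_threshold_loss expectation_threshold_loss q_def)
  then show "(\<integral>p. (U p)\<^sup>2 \<partial>P) = q * (1 - q)" by (simp add: power2_eq_square algebra_simps)
qed

lemma V_moments: "(\<integral>p. V p \<partial>P) = 0" "integrable P (\<lambda>p. (V p)\<^sup>2)" "(\<integral>p. (V p)\<^sup>2 \<partial>P) = \<Delta>\<^sup>2 / 4 * obs_variance"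
  using centred_obs_moments by (simp_all add: V_def power_mult_distrib power_divide obs_variance_def)

text \<open>What a fold tested on \<open>B\<close> and trained on \<open>T\<close> leaves over after
  linearisation, at scale sqrt k. The split risk involves one such error and the cross-validated
  risk two.\<close>

definition fold_error :: "nat set \<Rightarrow> nat set \<Rightarrow> nat \<Rightarrow> 'a \<Rightarrow> real" where
  "fold_error T B k \<omega> = (\<Sum>i\<in>B. loss T (\<lambda>i. X i \<omega>) (X i \<omega>)) / sqrt (real k) - sqrt (real k) * mean_risk M X k
     - ((\<Sum>i\<in>B. U (X i \<omega>)) + (\<Sum>i\<in>T. V (X i \<omega>))) / sqrt (real k)"

text \<open>The three terms are the test noise given the training fold, the linearisation error of
  the conditional risk, and the shift of the centring from \<open>q\<close> to the mean
  risk.\<close>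

lemma fold_error_eq:
  assumes T: "card T = k" "card B = k" "k \<ge> 1"
  shows "fold_error T B k \<omega> = (\<Sum>i\<in>B. centred_diff (\<xi> T \<omega>) (X i \<omega>)) / sqrt (real k)
     + sqrt (real k) * remainder (\<xi> T \<omega>) - sqrt (real k) * (mean_risk M X k - q)"
proof -
  let ?L = "\<Sum>i\<in>B. mean_loss (\<xi> T \<omega>) (X i \<omega>)" and ?U = "\<Sum>i\<in>B. U (X i \<omega>)" and ?V = "\<Sum>i\<in>T. V (X i \<omega>)"
  have s: "sqrt (real k) > 0" "real k / sqrt (real k) = sqrt (real k)"
    using T by (simp_all add: real_div_sqrt)
  have "(\<Sum>i\<in>B. centred_diff (\<xi> T \<omega>) (X i \<omega>)) = ?L - real k * R (\<xi> T \<omega>) - ?U"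
    using T by (simp add: centred_diff_def U_def sum_subtractf)
  then have 1: "(\<Sum>i\<in>B. centred_diff (\<xi> T \<omega>) (X i \<omega>)) / sqrt (real k)
      = ?L / sqrt (real k) - sqrt (real k) * R (\<xi> T \<omega>) - ?U / sqrt (real k)"
    using s by (simp add: diff_divide_distrib) (metis times_divide_eq_left)
  have "?V = real k * (\<Delta> / 2 * dev (\<xi> T \<omega>))"
    unfolding V_def sum_distrib_left[symmetric] using T by (simp add: \<xi>_def dev_eq)
  then have 2: "?V / sqrt (real k) = sqrt (real k) * (\<Delta> / 2 * dev (\<xi> T \<omega>))"
    using s by (metis times_divide_eq_left)
  have 3: "loss T (\<lambda>i. X i \<omega>) p = mean_loss (\<xi> T \<omega>) p" for p
    by (simp add: loss_eq_mean_loss \<xi>_def)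
  show ?thesis
    unfolding fold_error_def 3 add_divide_distrib 2 1 remainder_def by (simp add: algebra_simps)
qed

text \<open>The k summands contribute k times one conditional variance, and this k cancels against
  the square of sqrt k; the L1 norm is then bounded by the L2 norm.\<close>

lemma centred_sum:
  assumes T: "T \<subseteq> {1..}" "B \<subseteq> {1..}" "T \<inter> B = {}" "card T = k" "card B = k" "k \<ge> 1"
  shows "integrable M (\<lambda>\<omega>. \<bar>(\<Sum>i\<in>B. centred_diff (\<xi> T \<omega>) (X i \<omega>)) / sqrt (real k)\<bar>)"
    and "expectation (\<lambda>\<omega>. \<bar>(\<Sum>i\<in>B. centred_diff (\<xi> T \<omega>) (X i \<omega>)) / sqrt (real k)\<bar>)
        \<le> sqrt (expectation (\<lambda>\<omega>. \<integral>p. (centred_diff (\<xi> T \<omega>) p)\<^sup>2 \<partial>P))"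
proof -
  have fin: "finite B" using T by (metis card.infinite not_one_le_zero)
  have [measurable]: "X i \<in> measurable M obs_space" if "i \<in> B" for i using T that by auto
  have [measurable]: "(\<lambda>x. centred_diff (fst x) (snd x)) \<in> borel_measurable ((borel \<Otimes>\<^sub>M borel) \<Otimes>\<^sub>M obs_space)"
    using centred_diff_measurable by (simp add: case_prod_beta')
  note [measurable] = \<xi>_measurable[OF T(1)]
  have "(\<lambda>\<omega>. centred_diff (\<xi> T \<omega>) (X i \<omega>)) \<in> borel_measurable M" if "i \<in> B" for i
  proof -
    have [measurable]: "X i \<in> measurable M obs_space" using that by simp
    have "(\<lambda>\<omega>. (\<lambda>x. centred_diff (fst x) (snd x)) (\<xi> T \<omega>, X i \<omega>)) \<in> borel_measurable M" by measurable
    then show ?thesis by simp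
  qed
  then have meas: "(\<lambda>\<omega>. (\<Sum>i\<in>B. centred_diff (\<xi> T \<omega>) (X i \<omega>)) / sqrt (real k)) \<in> borel_measurable M"
    by (intro borel_measurable_divide borel_measurable_sum) auto
  have sq: "((\<Sum>i\<in>B. centred_diff (\<xi> T \<omega>) (X i \<omega>)) / sqrt (real k))\<^sup>2
      = (\<Sum>i\<in>B. centred_diff (\<xi> T \<omega>) (X i \<omega>))\<^sup>2 / real k" for \<omega>
    by (simp add: power_divide)
  have disj: "B \<inter> T = {}" using T by auto
  note S = sum_conditional_square[OF fin T(2) T(1) disj class_means_measurable centred_diff_measurable
      centred_diff_bound centred_diff_mean, folded \<xi>_restrict[unfolded fun_eq_iff, rule_format]]
  have i: "integrable M (\<lambda>\<omega>. ((\<Sum>i\<in>B. centred_diff (\<xi> T \<omega>) (X i \<omega>)) / sqrt (real k))\<^sup>2)"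
    unfolding sq by (intro Bochner_Integration.integrable_divide S)
  show "integrable M (\<lambda>\<omega>. \<bar>(\<Sum>i\<in>B. centred_diff (\<xi> T \<omega>) (X i \<omega>)) / sqrt (real k)\<bar>)"
    by (rule expectation_abs_le_sqrt(1)[OF meas i])
  have "expectation (\<lambda>\<omega>. ((\<Sum>i\<in>B. centred_diff (\<xi> T \<omega>) (X i \<omega>)) / sqrt (real k))\<^sup>2)
      = expectation (\<lambda>\<omega>. \<integral>p. (centred_diff (\<xi> T \<omega>) p)\<^sup>2 \<partial>P)"
    unfolding sq using S(2) T by simp
  with expectation_abs_le_sqrt(2)[OF meas i]
  show "expectation (\<lambda>\<omega>. \<bar>(\<Sum>i\<in>B. centred_diff (\<xi> T \<omega>) (X i \<omega>)) / sqrt (real k)\<bar>)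
        \<le> sqrt (expectation (\<lambda>\<omega>. \<integral>p. (centred_diff (\<xi> T \<omega>) p)\<^sup>2 \<partial>P))" by simp
qed

lemma fold_error_integrable:
  assumes T: "T \<subseteq> {1..}" "B \<subseteq> {1..}" "T \<inter> B = {}" "card T = k" "card B = k" "k \<ge> 1"
  shows "integrable M (fold_error T B k)"
    and "expectation (\<lambda>\<omega>. \<bar>fold_error T B k \<omega>\<bar>)
       \<le> sqrt (expectation (\<lambda>\<omega>. \<integral>p. (centred_diff (\<xi> T \<omega>) p)\<^sup>2 \<partial>P))
         + sqrt (real k) * expectation (\<lambda>\<omega>. \<bar>remainder (\<xi> T \<omega>)\<bar>)
         + sqrt (real k) * expectation (\<lambda>\<omega>. \<bar>remainder (\<xi> {1..k} \<omega>)\<bar>)"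
proof -
  define C where "C \<omega> = (\<Sum>i\<in>B. centred_diff (\<xi> T \<omega>) (X i \<omega>)) / sqrt (real k)" for \<omega>
  note CS = centred_sum[OF T, folded C_def]
  have eq: "fold_error T B k \<omega> = C \<omega> + sqrt (real k) * remainder (\<xi> T \<omega>) - sqrt (real k) * (mean_risk M X k - q)" for \<omega>
    using fold_error_eq T by (simp add: C_def)
  have irem: "integrable M (\<lambda>\<omega>. remainder (\<xi> T \<omega>))" by (rule remainder_integrable) (use T in auto)
  have meas: "C \<in> borel_measurable M"
  proof -
    have 1: "(\<lambda>\<omega>. centred_diff (\<xi> T \<omega>) (X i \<omega>)) \<in> borel_measurable M" if "i \<in> B" for i
    proof -
      have [measurable]: "X i \<in> measurable M obs_space" using that T by auto
      note [measurable] = \<xi>_measurable[OF T(1)]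
      have "(\<lambda>\<omega>. case_prod centred_diff (\<xi> T \<omega>, X i \<omega>)) \<in> borel_measurable M" by measurable
      then show ?thesis by simp
    qed
    show ?thesis unfolding C_def[abs_def] by (intro borel_measurable_divide borel_measurable_sum 1) auto
  qed
  have iC: "integrable M C" using CS(1) meas by (rule integrable_abs_cancel)
  have "integrable M (\<lambda>\<omega>. fold_error T B k \<omega>)"
    unfolding eq by (intro Bochner_Integration.integrable_diff Bochner_Integration.integrable_add
        Bochner_Integration.integrable_mult_right iC irem) auto
  then show int': "integrable M (fold_error T B k)" .
  then have int: "integrable M (\<lambda>\<omega>. \<bar>fold_error T B k \<omega>\<bar>)" by (rule integrable_abs)
  have "\<bar>mean_risk M X k - q\<bar> \<le> expectation (\<lambda>\<omega>. \<bar>remainder (\<xi> {1..k} \<omega>)\<bar>)"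
    unfolding mean_risk_diff[OF T(6)] using integral_abs_bound by blast
  then have mr: "sqrt (real k) * \<bar>mean_risk M X k - q\<bar> \<le> sqrt (real k) * expectation (\<lambda>\<omega>. \<bar>remainder (\<xi> {1..k} \<omega>)\<bar>)"
    by (intro mult_left_mono) auto
  have "expectation (\<lambda>\<omega>. \<bar>fold_error T B k \<omega>\<bar>)
      \<le> expectation (\<lambda>\<omega>. \<bar>C \<omega>\<bar> + sqrt (real k) * \<bar>remainder (\<xi> T \<omega>)\<bar> + sqrt (real k) * \<bar>mean_risk M X k - q\<bar>)"
  proof (rule integral_mono[OF int])
    show "integrable M (\<lambda>\<omega>. \<bar>C \<omega>\<bar> + sqrt (real k) * \<bar>remainder (\<xi> T \<omega>)\<bar> + sqrt (real k) * \<bar>mean_risk M X k - q\<bar>)"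
      by (intro Bochner_Integration.integrable_add Bochner_Integration.integrable_mult_right integrable_abs iC irem) auto
    show "\<bar>fold_error T B k \<omega>\<bar> \<le> \<bar>C \<omega>\<bar> + sqrt (real k) * \<bar>remainder (\<xi> T \<omega>)\<bar> + sqrt (real k) * \<bar>mean_risk M X k - q\<bar>" for \<omega>
    proof -
      have abs: "\<bar>sqrt (real k) * a\<bar> = sqrt (real k) * \<bar>a\<bar>" for a by (simp add: abs_mult)
      show ?thesis
        unfolding eq abs[symmetric] by linarith
    qed
  qed
  also have "\<dots> = expectation (\<lambda>\<omega>. \<bar>C \<omega>\<bar>) + sqrt (real k) * expectation (\<lambda>\<omega>. \<bar>remainder (\<xi> T \<omega>)\<bar>)
      + sqrt (real k) * \<bar>mean_risk M X k - q\<bar>"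
    using iC irem prob_space by simp
  finally show "expectation (\<lambda>\<omega>. \<bar>fold_error T B k \<omega>\<bar>)
       \<le> sqrt (expectation (\<lambda>\<omega>. \<integral>p. (centred_diff (\<xi> T \<omega>) p)\<^sup>2 \<partial>P))
         + sqrt (real k) * expectation (\<lambda>\<omega>. \<bar>remainder (\<xi> T \<omega>)\<bar>)
         + sqrt (real k) * expectation (\<lambda>\<omega>. \<bar>remainder (\<xi> {1..k} \<omega>)\<bar>)"
    using CS(2) mr by linarith
qed

text \<open>The bound from \<open>centred_diff_square\<close> is linear in \<bar>dev\<bar> and so of
  order k^(-1/2) in mean. No rate is asked of this term, only that it vanishes.\<close>

lemma centred_square_small:
  assumes "\<epsilon> > 0"
  shows "\<forall>\<^sub>F k in sequentially. \<forall>T. T \<subseteq> {1..} \<longrightarrow> card T = k \<longrightarrow>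
     sqrt (expectation (\<lambda>\<omega>. \<integral>p. (centred_diff (\<xi> T \<omega>) p)\<^sup>2 \<partial>P)) \<le> \<epsilon>"
proof -
  obtain K where K: "K \<ge> 0"
    "\<And>u. (\<integral>p. (centred_diff u p)\<^sup>2 \<partial>P) \<le> K * (\<bar>dev u\<bar> + (dev u)\<^sup>2 + (gap u)\<^sup>2)"
    using centred_diff_square by blast
  have "(\<lambda>k. K * (sqrt (obs_variance / real k) + obs_variance / real k + contrast_variance / real k)) \<longlonglongrightarrow> K * (sqrt 0 + 0 + 0)"
    by (intro tendsto_intros tendsto_divide_0[OF tendsto_const]
        filterlim_at_top_imp_at_infinity filterlim_real_sequentially)
  then have "\<forall>\<^sub>F k in sequentially. K * (sqrt (obs_variance / real k) + obs_variance / real k + contrast_variance / real k) < \<epsilon>\<^sup>2"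
    using assms by (intro order_tendstoD) auto
  then show ?thesis
    using eventually_ge_at_top[of 1]
  proof eventually_elim
    case (elim k)
    show ?case
    proof (intro allI impI)
      fix T :: "nat set" assume T: "T \<subseteq> {1..}" "card T = k"
      note T' = T elim(2)
      note [measurable] = \<xi>_measurable[OF T(1)]
      have i: "integrable M (\<lambda>\<omega>. \<bar>dev (\<xi> T \<omega>)\<bar>)" using dev_moments(3)[OF T'] by simp
      have [measurable]: "(\<lambda>x. centred_diff (fst x) (snd x)) \<in> borel_measurable ((borel \<Otimes>\<^sub>M borel) \<Otimes>\<^sub>M obs_space)"
        using centred_diff_measurable by (simp add: case_prod_beta')
      \<comment> \<open>16 is the square of the bound 4 in
        \<open>centred_diff_bound\<close>.\<close>
      have sqle: "(centred_diff u p)\<^sup>2 \<le> 16" for u p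
        using abs_le_square_iff[of "centred_diff u p" 4] centred_diff_bound[of u p] by simp
      have icd: "integrable P (\<lambda>p. (centred_diff u p)\<^sup>2)" for u
        by (rule bounded_integrable_P[where C = 16]) (use sqle in \<open>auto simp: centred_diff_def\<close>)
      have le16: "(\<integral>p. (centred_diff u p)\<^sup>2 \<partial>P) \<le> 16" for u
      proof -
        have "(\<integral>p. (centred_diff u p)\<^sup>2 \<partial>P) \<le> (\<integral>p. 16 \<partial>P)"
          by (intro integral_mono icd sqle) auto
        then show ?thesis using P.prob_space by simp
      qed
      have [measurable]: "(\<lambda>u. \<integral>p. (centred_diff u p)\<^sup>2 \<partial>P) \<in> borel_measurable (borel \<Otimes>\<^sub>M borel)"
        by (rule P.borel_measurable_lebesgue_integral) (simp add: case_prod_beta')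
      have "integrable M (\<lambda>\<omega>. \<integral>p. (centred_diff (\<xi> T \<omega>) p)\<^sup>2 \<partial>P)"
        by (rule integrable_const_bound[where B = 16]) (use le16 in auto)
      then have "expectation (\<lambda>\<omega>. \<integral>p. (centred_diff (\<xi> T \<omega>) p)\<^sup>2 \<partial>P)
          \<le> expectation (\<lambda>\<omega>. K * (\<bar>dev (\<xi> T \<omega>)\<bar> + (dev (\<xi> T \<omega>))\<^sup>2 + (gap (\<xi> T \<omega>))\<^sup>2))"
        using i dev_moments(1)[OF T'] gap_moments(1)[OF T'] by (intro integral_mono K) auto
      also have "\<dots> = K * (expectation (\<lambda>\<omega>. \<bar>dev (\<xi> T \<omega>)\<bar>) + obs_variance / k + contrast_variance / k)"
        using i dev_moments(1,2)[OF T'] gap_moments[OF T'] by simp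
      also have "\<dots> \<le> K * (sqrt (obs_variance / k) + obs_variance / k + contrast_variance / k)"
        using dev_moments(5)[OF T'] K by (intro mult_left_mono) auto
      also have "\<dots> \<le> \<epsilon>\<^sup>2" using elim(1) by simp
      finally show "sqrt (expectation (\<lambda>\<omega>. \<integral>p. (centred_diff (\<xi> T \<omega>) p)\<^sup>2 \<partial>P)) \<le> \<epsilon>"
        using assms by (intro real_le_lsqrt) auto
    qed
  qed
qed

lemma fold_error_small:
  assumes "\<epsilon> > 0"
  shows "\<forall>\<^sub>F k in sequentially. \<forall>T B. T \<subseteq> {1..} \<longrightarrow> B \<subseteq> {1..} \<longrightarrow> T \<inter> B = {} \<longrightarrow> card T = k \<longrightarrow> card B = k \<longrightarrow>
     expectation (\<lambda>\<omega>. \<bar>fold_error T B k \<omega>\<bar>) \<le> \<epsilon>"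
proof -
  from assms have e: "\<epsilon> / 3 > 0" by simp
  show ?thesis
    using centred_square_small[OF e] remainder_small[OF e] eventually_ge_at_top[of 1]
  proof eventually_elim
    case (elim k)
    show ?case
    proof (intro allI impI)
      fix T B :: "nat set" assume T: "T \<subseteq> {1..}" "B \<subseteq> {1..}" "T \<inter> B = {}" "card T = k" "card B = k"
      have K: "{1..k} \<subseteq> {1..}" "card {1..k} = k" by auto
      show "expectation (\<lambda>\<omega>. \<bar>fold_error T B k \<omega>\<bar>) \<le> \<epsilon>"
        using fold_error_integrable(2)[OF T elim(3)] elim(1)[rule_format, OF T(1,4)]
          elim(2)[rule_format, OF T(1,4)] elim(2)[rule_format, OF K] by linarith
    qed
  qed
qed

end

section \<open>The limit laws\<close>

text \<open>Two folds of size \<open>n div 2\<close> cover \<open>{1..n}\<close> only for even n,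
  hence limits along the even numbers.\<close>

lemma tendsto_even:
  assumes "((\<lambda>k. f (2 * k)) \<longlongrightarrow> l) sequentially"
  shows "(f \<longlongrightarrow> l) (inf at_top (principal {n::nat. even n}))"
  unfolding filterlim_iff
proof (intro allI impI)
  fix Q assume "eventually Q (nhds l)"
  with assms have "\<forall>\<^sub>F k in sequentially. Q (f (2 * k))" by (simp add: filterlim_iff)
  then obtain N where N: "\<And>k. k \<ge> N \<Longrightarrow> Q (f (2 * k))" by (auto simp: eventually_sequentially)
  have "Q (f n)" if "n \<ge> 2 * N" "even n" for n
    using N[of "n div 2"] that by auto
  then show "\<forall>\<^sub>F n in inf at_top (principal {n. even n}). Q (f n)"
    unfolding eventually_inf_principal eventually_sequentially by blast
qed

context labelled_sample
begin

definition \<rho> :: real where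
  "\<rho> = \<Delta> / 4 * (expect (g False) (\<lambda>z. z * of_bool (z > \<mu>)) + expect (g True) (\<lambda>z. z * of_bool (z \<le> \<mu>)) - 2 * q * \<mu>)"

section \<open>Identification of the limit variance and of the covariance\<close>

lemma square_deviation_L: "(\<integral>z. (z - \<mu>)\<^sup>2 \<partial>L c) = var (g c) + (m c - \<mu>)\<^sup>2"
proof -
  have v: "var (g c) = (\<integral>z. (z - m c)\<^sup>2 \<partial>L c)" by (simp add: var_def expect_def)
  have i: "integrable (L c) (\<lambda>z. (z - m c)\<^sup>2)" using affine_L(3)[where a = 1 and b = "- m c"] by simp
  have "(\<integral>z. (z - \<mu>)\<^sup>2 \<partial>L c) = (\<integral>z. (z - m c)\<^sup>2 + (2 * (m c - \<mu>) * z + ((m c - \<mu>)\<^sup>2 - 2 * (m c - \<mu>) * m c)) \<partial>L c)"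
    by (rule Bochner_Integration.integral_cong) (auto simp: power2_eq_square algebra_simps)
  also have "\<dots> = var (g c) + (2 * (m c - \<mu>) * m c + ((m c - \<mu>)\<^sup>2 - 2 * (m c - \<mu>) * m c))"
    unfolding v by (subst Bochner_Integration.integral_add[OF i affine_L(1)]) (simp only: affine_L)
  finally show ?thesis by simp
qed

text \<open>Variance within the classes plus variance between them: both class means lie at distance
  \<delta> / 2 from \<mu>.\<close>

lemma obs_variance_eq: "obs_variance = (var (g True) + var (g False) + \<delta>\<^sup>2 / 2) / 2"
proof -
  have i: "integrable (L c) (\<lambda>z. (z - \<mu>)\<^sup>2)" for c using affine_L(3)[where a = 1 and b = "- \<mu>"] by simp
  have "obs_variance = ((\<integral>z. (centred_obs (z, True))\<^sup>2 \<partial>L True) + (\<integral>z. (centred_obs (z, False))\<^sup>2 \<partial>L False)) / 2"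
    unfolding obs_variance_def by (intro mixture_P) (auto simp: centred_obs_def i)
  also have "\<dots> = (var (g True) + (m True - \<mu>)\<^sup>2 + (var (g False) + (m False - \<mu>)\<^sup>2)) / 2"
    by (simp add: centred_obs_def square_deviation_L)
  also have "m True - \<mu> = \<delta> / 2" by (simp add: \<mu>_def \<delta>_def field_simps)
  also have "m False - \<mu> = - \<delta> / 2" by (simp add: \<mu>_def \<delta>_def field_simps)
  finally show ?thesis by (simp add: power_divide)
qed

lemma V_variance: "\<Delta>\<^sup>2 / 4 * obs_variance = \<Delta>\<^sup>2 / 8 * (var (g True) + var (g False) + 1/2 * (m True - m False)\<^sup>2)"
  unfolding obs_variance_eq \<delta>_def by simp

text \<open>The loss at threshold \<mu> is 1 for z \<le> \<mu> in class \<open>True\<close> and for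
  z > \<mu> in class \<open>False\<close>, which produces the two truncated expectations in
  \<open>\<rho>\<close>. Centring the loss by \<open>q\<close> changes nothing since
  \<open>V\<close> has mean zero; centring the observation by \<mu> gives the term with
  \<open>q * \<mu>\<close>.\<close>

lemma UV_integrable: "integrable P (\<lambda>p. U p * V p)" and UV_expectation: "(\<integral>p. U p * V p \<partial>P) = \<rho>"
proof -
  have bound: "\<bar>threshold_loss \<mu> (z, c) * z\<bar> \<le> \<bar>z\<bar>" for z c
    by (simp add: threshold_loss_def)
  have iL: "integrable (L c) (\<lambda>z. threshold_loss \<mu> (z, c) * z)" for c
    by (rule Bochner_Integration.integrable_bound[OF integrable_id_L]) (use bound in auto)
  have i: "integrable P (\<lambda>p. threshold_loss \<mu> p * fst p)"
    by (rule mixture_P) (use iL in auto)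
  have "(\<integral>p. threshold_loss \<mu> p * fst p \<partial>P)
      = ((\<integral>z. threshold_loss \<mu> (z, True) * z \<partial>L True) + (\<integral>z. threshold_loss \<mu> (z, False) * z \<partial>L False)) / 2"
    using mixture_P(2)[of "\<lambda>p. threshold_loss \<mu> p * fst p"] iL by simp
  also have "(\<integral>z. threshold_loss \<mu> (z, True) * z \<partial>L True) = expect (g True) (\<lambda>z. z * of_bool (z \<le> \<mu>))"
    unfolding expect_def by (rule Bochner_Integration.integral_cong) (auto simp: threshold_loss_def)
  also have "(\<integral>z. threshold_loss \<mu> (z, False) * z \<partial>L False) = expect (g False) (\<lambda>z. z * of_bool (z > \<mu>))"
    unfolding expect_def by (rule Bochner_Integration.integral_cong) (auto simp: threshold_loss_def)
  finally have e: "(\<integral>p. threshold_loss \<mu> p * fst p \<partial>P)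
     = (expect (g True) (\<lambda>z. z * of_bool (z \<le> \<mu>)) + expect (g False) (\<lambda>z. z * of_bool (z > \<mu>))) / 2" .
  have icentred: "integrable P centred_obs" by (rule P.square_integrable_imp_integrable[OF _ centred_obs_moments(2)]) simp
  have eq: "U p * V p = \<Delta> / 2 * (threshold_loss \<mu> p * fst p - \<mu> * threshold_loss \<mu> p - q * centred_obs p)" for p
  proof -
    have "(l - q) * (d * (x - \<mu>)) = d * (l * x - \<mu> * l - q * (x - \<mu>))" for l d x :: real
      by (simp add: algebra_simps)
    then show ?thesis unfolding U_def V_def centred_obs_def .
  qed
  show "integrable P (\<lambda>p. U p * V p)"
    unfolding eq by (intro Bochner_Integration.integrable_mult_right Bochner_Integration.integrable_diff i
        integrable_threshold_loss icentred)
  have "(\<integral>p. U p * V p \<partial>P) = \<Delta> / 2 * ((\<integral>p. threshold_loss \<mu> p * fst p \<partial>P) - \<mu> * q - q * 0)"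
    unfolding eq using i integrable_threshold_loss icentred
    by (simp add: centred_obs_moments(1) expectation_threshold_loss q_def)
  then show "(\<integral>p. U p * V p \<partial>P) = \<rho>"
    unfolding e \<rho>_def by (simp add: field_simps)
qed

lemma UV_moments:
  "(\<integral>p. U p + V p \<partial>P) = 0" "integrable P (\<lambda>p. (U p + V p)\<^sup>2)"
  "(\<integral>p. (U p + V p)\<^sup>2 \<partial>P) = q * (1 - q) + \<Delta>\<^sup>2 / 4 * obs_variance + 2 * \<rho>"
proof -
  have i: "integrable P U" "integrable P V"
    by (rule P.square_integrable_imp_integrable, use U_moments V_moments in auto)+
  then show "(\<integral>p. U p + V p \<partial>P) = 0" using U_moments V_moments by simp
  have eq: "(U p + V p)\<^sup>2 = (U p)\<^sup>2 + (V p)\<^sup>2 + 2 * (U p * V p)" for p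
    by (simp add: power2_sum)
  show "integrable P (\<lambda>p. (U p + V p)\<^sup>2)"
    unfolding eq using U_moments V_moments UV_integrable
    by (intro Bochner_Integration.integrable_add Bochner_Integration.integrable_mult_right) auto
  show "(\<integral>p. (U p + V p)\<^sup>2 \<partial>P) = q * (1 - q) + \<Delta>\<^sup>2 / 4 * obs_variance + 2 * \<rho>"
    unfolding eq using U_moments V_moments UV_integrable UV_expectation by simp
qed

lemma fold_facts:
  assumes "two_folds (2 * k) B"
  shows "B 1 \<subseteq> {1..}" "B 2 \<subseteq> {1..}" "B 1 \<inter> B 2 = {}" "B 2 \<inter> B 1 = {}" "card (B 1) = k" "card (B 2) = k"
    "finite (B 1)" "finite (B 2)" "B 1 \<union> B 2 = {1..2 * k}"
    "{1..2 * k} - B 1 = B 2" "{1..2 * k} - B 2 = B 1"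
proof -
  have u: "B 1 \<union> B 2 = {1..2 * k}" and d: "B 1 \<inter> B 2 = {}" and c: "card (B 1) = k" "card (B 2) = k"
    using assms by (auto simp: two_folds_def)
  from u have "B 1 \<subseteq> {1..2 * k}" "B 2 \<subseteq> {1..2 * k}" by blast+
  then show "B 1 \<subseteq> {1..}" "B 2 \<subseteq> {1..}" "finite (B 1)" "finite (B 2)"
    by (auto intro: finite_subset)
  show "{1..2 * k} - B 1 = B 2" "{1..2 * k} - B 2 = B 1" unfolding u[symmetric] using d by blast+
  show "B 1 \<union> B 2 = {1..2 * k}" "B 1 \<inter> B 2 = {}" "B 2 \<inter> B 1 = {}" "card (B 1) = k" "card (B 2) = k"
    using u d c by auto
qed

lemma fold_error_tendsto_0:
  assumes folds: "\<And>n. even n \<Longrightarrow> two_folds n (B n)"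
    and ij: "i = 1 \<and> j = 2 \<or> i = 2 \<and> j = 1"
  shows "(\<lambda>k. expectation (\<lambda>\<omega>. \<bar>fold_error (B (2 * k) i) (B (2 * k) j) k \<omega>\<bar>)) \<longlonglongrightarrow> 0"
proof (rule tendstoI)
  fix e :: real assume e: "e > 0"
  then have "e / 2 > 0" by simp
  from fold_error_small[OF this]
  show "\<forall>\<^sub>F k in sequentially. dist (expectation (\<lambda>\<omega>. \<bar>fold_error (B (2 * k) i) (B (2 * k) j) k \<omega>\<bar>)) 0 < e"
  proof eventually_elim
    case (elim k)
    have "two_folds (2 * k) (B (2 * k))" by (rule folds) simp
    note ff = fold_facts[OF this]
    have "expectation (\<lambda>\<omega>. \<bar>fold_error (B (2 * k) i) (B (2 * k) j) k \<omega>\<bar>) \<le> e / 2"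
      using elim[rule_format, of "B (2 * k) i" "B (2 * k) j"] ij ff by blast
    moreover have "0 \<le> expectation (\<lambda>\<omega>. \<bar>fold_error (B (2 * k) i) (B (2 * k) j) k \<omega>\<bar>)" by simp
    ultimately show ?case using e by simp
  qed
qed

lemma split_limit:
  assumes folds: "\<And>n. even n \<Longrightarrow> two_folds n (B n)"
  shows "((\<lambda>n. wasserstein1
        (distr M borel (\<lambda>\<omega>. sqrt (real n / 2) * (split_risk n (B n) (\<lambda>i. X i \<omega>) - mean_risk M X (n div 2))))
        (normal_law 0 (q * (1 - q) + \<Delta>\<^sup>2 / 4 * obs_variance))) \<longlongrightarrow> 0) (inf at_top (principal {n. even n}))"
\<comment> \<open>After passing to k = n / 2, the shift to \<open>Suc k\<close> excludes k = 0,
  where the folds are empty and there is no division by sqrt k.\<close>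
proof (rule tendsto_even, rule filterlim_sequentially_Suc[THEN iffD1])
  define v where "v = q * (1 - q) + \<Delta>\<^sup>2 / 4 * obs_variance"
  have v_eq: "v = (\<integral>p. (U p)\<^sup>2 \<partial>P) + (\<integral>p. (V p)\<^sup>2 \<partial>P)" using U_moments V_moments by (simp add: v_def)
  have v0: "v \<ge> 0" unfolding v_eq by (intro add_nonneg_nonneg) simp_all
  define T where "T k = B (2 * k) 2" for k
  define E where "E k = B (2 * k) 1" for k
  have "two_folds (2 * k) (B (2 * k))" for k by (rule folds) simp
  note ff = fold_facts[OF this, folded T_def E_def]
  define A where "A k \<omega> = sqrt (real (2 * k) / 2) * (split_risk (2 * k) (B (2 * k)) (\<lambda>i. X i \<omega>) - mean_risk M X (2 * k div 2))" for k \<omega>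
  define SU where "SU k \<omega> = (\<Sum>i\<in>E k. U (X i \<omega>))" for k \<omega>
  define SV where "SV k \<omega> = (\<Sum>i\<in>T k. V (X i \<omega>))" for k \<omega>
  define S where "S k \<omega> = (SU k \<omega> + SV k \<omega>) / sqrt (real k)" for k \<omega>
  have AS: "A (Suc k) \<omega> = S (Suc k) \<omega> + fold_error (T (Suc k)) (E (Suc k)) (Suc k) \<omega>" for k \<omega>
  proof -
    define s where "s = sqrt (real (Suc k))"
    have s: "s > 0" "real (Suc k) = s * s" by (simp_all add: s_def)
    have "A (Suc k) \<omega> = s * (2 / real (2 * Suc k) * (\<Sum>i\<in>E (Suc k). loss (T (Suc k)) (\<lambda>i. X i \<omega>) (X i \<omega>)) - mean_risk M X (Suc k))"
      unfolding A_def split_risk_def E_def[symmetric] ff(10) s_def by simp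
    also have "2 / real (2 * Suc k) = 1 / (s * s)" unfolding s(2)[symmetric] by (simp add: field_simps)
    also have "s * (1 / (s * s) * (\<Sum>i\<in>E (Suc k). loss (T (Suc k)) (\<lambda>i. X i \<omega>) (X i \<omega>)) - mean_risk M X (Suc k))
        = (\<Sum>i\<in>E (Suc k). loss (T (Suc k)) (\<lambda>i. X i \<omega>) (X i \<omega>)) / s - s * mean_risk M X (Suc k)"
      using s(1) by (simp add: right_diff_distrib)
    finally show ?thesis
      unfolding S_def SU_def SV_def fold_error_def s_def[symmetric] by simp
  qed
  have XE: "X i \<in> measurable M obs_space" if "i \<in> E k" for i k using that ff(1)[of k] by auto
  have XT: "X i \<in> measurable M obs_space" if "i \<in> T k" for i k using that ff(2)[of k] by auto
  have SUm [measurable]: "SU k \<in> borel_measurable M" and SVm [measurable]: "SV k \<in> borel_measurable M" for k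
    unfolding SU_def[abs_def] SV_def[abs_def]
    by (intro borel_measurable_sum measurable_compose[OF XE U_measurable] measurable_compose[OF XT V_measurable]; assumption)+
  have Sm [measurable]: "S k \<in> borel_measurable M" for k
    unfolding S_def[abs_def] by measurable
  have ie: "integrable M (fold_error (T (Suc k)) (E (Suc k)) (Suc k))" for k
    by (rule fold_error_integrable) (use ff[of "Suc k"] in auto)
  have SU2: "integrable M (\<lambda>\<omega>. (SU k \<omega>)\<^sup>2)" "expectation (\<lambda>\<omega>. (SU k \<omega>)\<^sup>2) = real k * (\<integral>p. (U p)\<^sup>2 \<partial>P)" for k
    using sum_iid_square[OF ff(7) ff(1) U_measurable U_moments(2,1), of k] ff(5)[of k] unfolding SU_def by simp_all
  have SV2: "integrable M (\<lambda>\<omega>. (SV k \<omega>)\<^sup>2)" "expectation (\<lambda>\<omega>. (SV k \<omega>)\<^sup>2) = real k * (\<integral>p. (V p)\<^sup>2 \<partial>P)" for k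
    using sum_iid_square[OF ff(8) ff(2) V_measurable V_moments(2,1), of k] ff(6)[of k] unfolding SV_def by simp_all
  \<comment> \<open>The crude factor 2 suffices: only a uniform bound on second moments enters here,
    while the exact variance comes from the characteristic functions.\<close>
  have Sle: "(S (Suc k) \<omega>)\<^sup>2 \<le> (2 / real (Suc k)) * ((SU (Suc k) \<omega>)\<^sup>2 + (SV (Suc k) \<omega>)\<^sup>2)" for k \<omega>
  proof -
    have "(a + b)\<^sup>2 \<le> 2 * (a\<^sup>2 + b\<^sup>2)" for a b :: real
      using zero_le_power2[of "a - b"] by (simp add: power2_sum power2_diff)
    then have "(SU (Suc k) \<omega> + SV (Suc k) \<omega>)\<^sup>2 / real (Suc k) \<le> 2 * ((SU (Suc k) \<omega>)\<^sup>2 + (SV (Suc k) \<omega>)\<^sup>2) / real (Suc k)"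
      by (rule divide_right_mono) simp
    then show ?thesis by (simp add: S_def power_divide)
  qed
  have ib: "integrable M (\<lambda>\<omega>. (2 / real (Suc k)) * ((SU (Suc k) \<omega>)\<^sup>2 + (SV (Suc k) \<omega>)\<^sup>2))" for k
    by (intro Bochner_Integration.integrable_mult_right Bochner_Integration.integrable_add SU2 SV2)
  have S2: "integrable M (\<lambda>\<omega>. (S (Suc k) \<omega>)\<^sup>2)" for k
    by (rule Bochner_Integration.integrable_bound[OF ib[of k]])
       (auto intro!: AE_I2 order_trans[OF Sle] abs_ge_self simp del: of_nat_Suc)
  have "(\<lambda>k. wasserstein1 (distr M borel (A (Suc k))) (normal_law 0 v)) \<longlonglongrightarrow> 0"
  proof (rule wasserstein1_tendsto_0[where S = "\<lambda>k. S (Suc k)" and c = "2 * v"])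
    show "prob_space M" by (rule prob_space_axioms)
    show "real_distribution (normal_law 0 v)" "integrable (normal_law 0 v) (\<lambda>x. x\<^sup>2)"
      using normal_law_facts[OF v0] by auto
    show "A (Suc k) \<in> borel_measurable M" for k
      using ie[of k] unfolding AS[abs_def] by measurable
    show "S (Suc k) \<in> borel_measurable M" for k by measurable
    show "integrable M (\<lambda>\<omega>. (S (Suc k) \<omega>)\<^sup>2)" for k by (rule S2)
    show "expectation (\<lambda>\<omega>. (S (Suc k) \<omega>)\<^sup>2) \<le> 2 * v" for k
    proof -
      have "expectation (\<lambda>\<omega>. (S (Suc k) \<omega>)\<^sup>2)
          \<le> expectation (\<lambda>\<omega>. (2 / real (Suc k)) * ((SU (Suc k) \<omega>)\<^sup>2 + (SV (Suc k) \<omega>)\<^sup>2))"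
        by (intro integral_mono S2 ib Sle)
      also have "\<dots> = (2 / real (Suc k)) * (real (Suc k) * (\<integral>p. (U p)\<^sup>2 \<partial>P) + real (Suc k) * (\<integral>p. (V p)\<^sup>2 \<partial>P))"
        using SU2[of "Suc k"] SV2[of "Suc k"] by simp
      also have "\<dots> = 2 * v" unfolding v_eq distrib_left[symmetric] by simp
      finally show ?thesis .
    qed
    show "integrable M (\<lambda>\<omega>. \<bar>A (Suc k) \<omega> - S (Suc k) \<omega>\<bar>)" for k
      using ie[of k] by (simp add: AS)
    show "(\<lambda>k. expectation (\<lambda>\<omega>. \<bar>A (Suc k) \<omega> - S (Suc k) \<omega>\<bar>)) \<longlonglongrightarrow> 0"
      using fold_error_tendsto_0[OF folds, of 2 1, THEN LIMSEQ_Suc] by (simp add: AS T_def E_def)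
    fix t
    have "char (distr M borel (S k)) t = char (distr P borel U) (t / sqrt (real k)) ^ k * char (distr P borel V) (t / sqrt (real k)) ^ k" for k
    proof -
      \<comment> \<open>One index-dependent summand over all 2 k observations. The folds are
        disjoint, so the characteristic function factors into a power for \<open>U\<close> and a
        power for \<open>V\<close>.\<close>
      let ?f = "\<lambda>i. if i \<in> E k then U else V"
      have "S k = (\<lambda>\<omega>. (1 / sqrt (real k)) * (\<Sum>i\<in>E k \<union> T k. ?f i (X i \<omega>)))"
      proof
        fix \<omega>
        have "(\<Sum>i\<in>E k \<union> T k. ?f i (X i \<omega>)) = (\<Sum>i\<in>E k. ?f i (X i \<omega>)) + (\<Sum>i\<in>T k. ?f i (X i \<omega>))"
          using ff[of k] by (intro sum.union_disjoint) auto
        also have "(\<Sum>i\<in>E k. ?f i (X i \<omega>)) = SU k \<omega>" unfolding SU_def by (rule sum.cong) auto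
        also have "(\<Sum>i\<in>T k. ?f i (X i \<omega>)) = SV k \<omega>"
          unfolding SV_def by (rule sum.cong) (use ff(3)[of k] in auto)
        finally show "S k \<omega> = (1 / sqrt (real k)) * (\<Sum>i\<in>E k \<union> T k. ?f i (X i \<omega>))" by (simp add: S_def)
      qed
      then have "char (distr M borel (S k)) t = (\<Prod>i\<in>E k \<union> T k. char (distr P borel (?f i)) (1 / sqrt (real k) * t))"
        using ff(1,2)[of k] by (simp only:) (rule char_sum, auto)
      also have "\<dots> = (\<Prod>i\<in>E k. char (distr P borel (?f i)) (1 / sqrt (real k) * t))
          * (\<Prod>i\<in>T k. char (distr P borel (?f i)) (1 / sqrt (real k) * t))"
        using ff[of k] by (intro prod.union_disjoint) auto
      also have "(\<Prod>i\<in>E k. char (distr P borel (?f i)) (1 / sqrt (real k) * t)) = (\<Prod>i\<in>E k. char (distr P borel U) (t / sqrt (real k)))"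
        by (rule prod.cong) auto
      also have "(\<Prod>i\<in>T k. char (distr P borel (?f i)) (1 / sqrt (real k) * t)) = (\<Prod>i\<in>T k. char (distr P borel V) (t / sqrt (real k)))"
        by (rule prod.cong) (use ff(3)[of k] in auto)
      finally show ?thesis using ff(5,6)[of k] by simp
    qed
    moreover have "(\<lambda>k. char (distr P borel U) (t / sqrt (real k)) ^ k * char (distr P borel V) (t / sqrt (real k)) ^ k)
      \<longlonglongrightarrow> complex_of_real (exp (- (\<integral>p. (U p)\<^sup>2 \<partial>P) * t\<^sup>2 / 2)) * complex_of_real (exp (- (\<integral>p. (V p)\<^sup>2 \<partial>P) * t\<^sup>2 / 2))"
      by (intro tendsto_mult char_power_tendsto U_measurable V_measurable U_moments V_moments)
    moreover have "complex_of_real (exp (- (\<integral>p. (U p)\<^sup>2 \<partial>P) * t\<^sup>2 / 2)) * complex_of_real (exp (- (\<integral>p. (V p)\<^sup>2 \<partial>P) * t\<^sup>2 / 2))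
      = char (normal_law 0 v) t"
      unfolding normal_law_facts(3)[OF v0] unfolding v_eq of_real_mult[symmetric] exp_add[symmetric]
      by (simp add: field_simps)
    ultimately have "(\<lambda>k. char (distr M borel (S k)) t) \<longlonglongrightarrow> char (normal_law 0 v) t" by simp
    then show "(\<lambda>k. char (distr M borel (S (Suc k))) t) \<longlonglongrightarrow> char (normal_law 0 v) t"
      by (rule LIMSEQ_Suc)
  qed
  then show "(\<lambda>k. wasserstein1
        (distr M borel (\<lambda>\<omega>. sqrt (real (2 * Suc k) / 2) * (split_risk (2 * Suc k) (B (2 * Suc k)) (\<lambda>i. X i \<omega>) - mean_risk M X (2 * Suc k div 2))))
        (normal_law 0 (q * (1 - q) + \<Delta>\<^sup>2 / 4 * obs_variance))) \<longlonglongrightarrow> 0"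
    by (simp only: A_def[abs_def] v_def)
qed

lemma cv_limit:
  assumes folds: "\<And>n. even n \<Longrightarrow> two_folds n (B n)"
  shows "((\<lambda>n. wasserstein1
        (distr M borel (\<lambda>\<omega>. sqrt (real n) * (cv_risk n (B n) (\<lambda>i. X i \<omega>) - mean_risk M X (n div 2))))
        (normal_law 0 (q * (1 - q) + \<Delta>\<^sup>2 / 4 * obs_variance + 2 * \<rho>))) \<longlongrightarrow> 0) (inf at_top (principal {n. even n}))"
proof (rule tendsto_even, rule filterlim_sequentially_Suc[THEN iffD1])
  define W where "W p = U p + V p" for p
  have Wm [measurable]: "W \<in> borel_measurable obs_space" unfolding W_def[abs_def] by measurable
  note W_moments = UV_moments[folded W_def]
  define v where "v = q * (1 - q) + \<Delta>\<^sup>2 / 4 * obs_variance + 2 * \<rho>"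
  have v_eq: "v = (\<integral>p. (W p)\<^sup>2 \<partial>P)" using W_moments by (simp add: v_def)
  have v0: "v \<ge> 0" unfolding v_eq by simp
  define B1 where "B1 k = B (2 * k) 1" for k
  define B2 where "B2 k = B (2 * k) 2" for k
  have "two_folds (2 * k) (B (2 * k))" for k by (rule folds) simp
  note ff = fold_facts[OF this, folded B1_def B2_def]
  define A where "A k \<omega> = sqrt (real (2 * k)) * (cv_risk (2 * k) (B (2 * k)) (\<lambda>i. X i \<omega>) - mean_risk M X (2 * k div 2))" for k \<omega>
  \<comment> \<open>Every observation is tested once and trains once, so the \<open>U\<close> and
    \<open>V\<close> sums of the two folds merge into one i.i.d. sum of \<open>W\<close>.\<close>
  define S where "S k \<omega> = (1 / sqrt (real (2 * k))) * (\<Sum>i\<in>{1..2 * k}. W (X i \<omega>))" for k \<omega>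
  define e1 where "e1 k = fold_error (B2 k) (B1 k) k" for k
  define e2 where "e2 k = fold_error (B1 k) (B2 k) k" for k
  \<comment> \<open>At scale \<open>sqrt (2 * k)\<close>, the average of the two fold risks is the
    sum of the two fold quantities at scale sqrt k, divided by \<open>sqrt 2\<close>.\<close>
  have AS: "A (Suc k) \<omega> = S (Suc k) \<omega> + (e1 (Suc k) \<omega> + e2 (Suc k) \<omega>) / sqrt 2" for k \<omega>
  proof -
    define s where "s = sqrt (real (Suc k))"
    define c :: real where "c = sqrt 2"
    have s: "s > 0" "real (Suc k) = s * s" by (simp_all add: s_def)
    have c: "c > 0" "c * c = 2" by (simp_all add: c_def)
    have sc: "sqrt (real (2 * Suc k)) = c * s" by (simp only: c_def s_def of_nat_mult of_nat_numeral real_sqrt_mult)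
    define L1 where "L1 = (\<Sum>i\<in>B1 (Suc k). loss (B2 (Suc k)) (\<lambda>i. X i \<omega>) (X i \<omega>))"
    define L2 where "L2 = (\<Sum>i\<in>B2 (Suc k). loss (B1 (Suc k)) (\<lambda>i. X i \<omega>) (X i \<omega>))"
    define W1 where "W1 = (\<Sum>i\<in>B1 (Suc k). U (X i \<omega>)) + (\<Sum>i\<in>B2 (Suc k). V (X i \<omega>))"
    define W2 where "W2 = (\<Sum>i\<in>B2 (Suc k). U (X i \<omega>)) + (\<Sum>i\<in>B1 (Suc k). V (X i \<omega>))"
    define mr where "mr = mean_risk M X (Suc k)"
    have "(\<Sum>i\<in>{1..2 * Suc k}. W (X i \<omega>)) = (\<Sum>i\<in>B1 (Suc k). W (X i \<omega>)) + (\<Sum>i\<in>B2 (Suc k). W (X i \<omega>))"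
      unfolding ff(9)[symmetric] using ff[of "Suc k"] by (intro sum.union_disjoint) auto
    then have SW: "S (Suc k) \<omega> = (W1 + W2) / (c * s)"
      unfolding S_def sc W1_def W2_def W_def sum.distrib by simp
    have e: "e1 (Suc k) \<omega> = L1 / s - s * mr - W1 / s" "e2 (Suc k) \<omega> = L2 / s - s * mr - W2 / s"
      by (simp_all only: e1_def e2_def fold_error_def L1_def L2_def W1_def W2_def mr_def s_def)
    have "A (Suc k) \<omega> = c * s * (1 / real (2 * Suc k) * (L1 + L2) - mr)"
    proof -
      have "{1..2::nat} = {1, 2}" by auto
      then have "cv_risk (2 * Suc k) (B (2 * Suc k)) (\<lambda>i. X i \<omega>) = 1 / real (2 * Suc k) * (L1 + L2)"
        unfolding cv_risk_def L1_def L2_def using ff(10,11)[of "Suc k"] by (simp add: B1_def B2_def)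
      then show ?thesis unfolding A_def sc mr_def by simp
    qed
    also have "real (2 * Suc k) = (c * s) * (c * s)"
    proof -
      have "(c * s) * (c * s) = (c * c) * (s * s)" by (simp only: mult_ac)
      then show ?thesis unfolding c(2) s(2)[symmetric] by simp
    qed
    also have "c * s * (1 / ((c * s) * (c * s)) * (L1 + L2) - mr) = (L1 + L2) / (c * s) - c * s * mr"
      using s c by (simp add: field_simps)
    \<comment> \<open>Since \<open>c * c = 2\<close>, this distributes the mean risk evenly over the
      two folds.\<close>
    also have "c * s * mr = 2 * s * mr / c"
      using c by (simp add: field_simps)
    also have "(L1 + L2) / (c * s) - 2 * s * mr / c = S (Suc k) \<omega> + (e1 (Suc k) \<omega> + e2 (Suc k) \<omega>) / c"
      unfolding SW e by (simp add: add_divide_distrib diff_divide_distrib mult_ac)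
    finally show ?thesis by (simp add: c_def)
  qed
  have Xm: "X i \<in> measurable M obs_space" if "i \<in> {1..2 * k}" for i k using that by auto
  have Sm [measurable]: "S k \<in> borel_measurable M" for k
    unfolding S_def[abs_def] by (intro borel_measurable_times borel_measurable_const borel_measurable_sum
        measurable_compose[OF Xm Wm]; assumption)
  have ie: "integrable M (e1 (Suc k))" "integrable M (e2 (Suc k))" for k
    unfolding e1_def e2_def by (rule fold_error_integrable; use ff[of "Suc k"] in auto)+
  have sub: "{1..2 * k} \<subseteq> {1..}" for k :: nat by auto
  have Seq: "(S k \<omega>)\<^sup>2 = (\<Sum>i\<in>{1..2 * k}. W (X i \<omega>))\<^sup>2 / real (2 * k)" for k \<omega>
    by (simp add: S_def power_mult_distrib power_divide)
  note SW = sum_iid_square[OF finite_atLeastAtMost sub Wm W_moments(2,1)]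
  have "(\<lambda>k. wasserstein1 (distr M borel (A (Suc k))) (normal_law 0 v)) \<longlonglongrightarrow> 0"
  proof (rule wasserstein1_tendsto_0[where S = "\<lambda>k. S (Suc k)" and c = v])
    show "prob_space M" by (rule prob_space_axioms)
    show "real_distribution (normal_law 0 v)" "integrable (normal_law 0 v) (\<lambda>x. x\<^sup>2)"
      using normal_law_facts[OF v0] by auto
    show "A (Suc k) \<in> borel_measurable M" for k
      using ie[of k] unfolding AS[abs_def] by measurable
    show "S (Suc k) \<in> borel_measurable M" for k by measurable
    show "integrable M (\<lambda>\<omega>. (S (Suc k) \<omega>)\<^sup>2)" for k
      unfolding Seq by (intro Bochner_Integration.integrable_divide SW)
    have "expectation (\<lambda>\<omega>. (S (Suc k) \<omega>)\<^sup>2) = v" for k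
      unfolding Seq using SW(2)[of "Suc k"] by (simp add: v_eq)
    then show "expectation (\<lambda>\<omega>. (S (Suc k) \<omega>)\<^sup>2) \<le> v" for k by simp
    have AS': "A (Suc k) \<omega> - S (Suc k) \<omega> = (e1 (Suc k) \<omega> + e2 (Suc k) \<omega>) / sqrt 2" for k \<omega>
      by (simp add: AS)
    show int: "integrable M (\<lambda>\<omega>. \<bar>A (Suc k) \<omega> - S (Suc k) \<omega>\<bar>)" for k
      unfolding AS' using ie[of k] by (intro integrable_abs Bochner_Integration.integrable_divide Bochner_Integration.integrable_add)
    have "(\<lambda>k. expectation (\<lambda>\<omega>. \<bar>e1 (Suc k) \<omega>\<bar>) + expectation (\<lambda>\<omega>. \<bar>e2 (Suc k) \<omega>\<bar>)) \<longlonglongrightarrow> 0 + 0"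
      unfolding e1_def e2_def B1_def B2_def
      by (intro tendsto_add fold_error_tendsto_0[OF folds, THEN LIMSEQ_Suc]) auto
    then have lim: "(\<lambda>k. expectation (\<lambda>\<omega>. \<bar>e1 (Suc k) \<omega>\<bar>) + expectation (\<lambda>\<omega>. \<bar>e2 (Suc k) \<omega>\<bar>)) \<longlonglongrightarrow> 0" by simp
    have "expectation (\<lambda>\<omega>. \<bar>A (Suc k) \<omega> - S (Suc k) \<omega>\<bar>) \<le> expectation (\<lambda>\<omega>. \<bar>e1 (Suc k) \<omega>\<bar>) + expectation (\<lambda>\<omega>. \<bar>e2 (Suc k) \<omega>\<bar>)" for k
    proof -
      have "expectation (\<lambda>\<omega>. \<bar>A (Suc k) \<omega> - S (Suc k) \<omega>\<bar>) \<le> expectation (\<lambda>\<omega>. \<bar>e1 (Suc k) \<omega>\<bar> + \<bar>e2 (Suc k) \<omega>\<bar>)"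
      proof (rule integral_mono[OF int])
        show "integrable M (\<lambda>\<omega>. \<bar>e1 (Suc k) \<omega>\<bar> + \<bar>e2 (Suc k) \<omega>\<bar>)" using ie[of k] by auto
        have "\<bar>x / sqrt 2\<bar> \<le> \<bar>x\<bar>" for x :: real
          unfolding abs_divide by (rule divide_le_eq[THEN iffD2]) (simp add: mult_le_cancel_left1)
        then show "\<bar>A (Suc k) \<omega> - S (Suc k) \<omega>\<bar> \<le> \<bar>e1 (Suc k) \<omega>\<bar> + \<bar>e2 (Suc k) \<omega>\<bar>" for \<omega>
          unfolding AS' using order_trans abs_triangle_ineq by blast
      qed
      then show ?thesis using ie[of k] by simp
    qed
    then show "(\<lambda>k. expectation (\<lambda>\<omega>. \<bar>A (Suc k) \<omega> - S (Suc k) \<omega>\<bar>)) \<longlonglongrightarrow> 0"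
      by (intro tendsto_sandwich[OF _ _ tendsto_const lim]) auto
    fix t
    have "char (distr M borel (S k)) t = char (distr P borel W) (t / sqrt (real (2 * k))) ^ (2 * k)" for k
      unfolding S_def[abs_def] by (subst char_sum) (use sub in auto)
    moreover have "(\<lambda>k. char (distr P borel W) (t / sqrt (real (2 * k))) ^ (2 * k)) \<longlonglongrightarrow> char (normal_law 0 v) t"
    proof -
      \<comment> \<open>The sum has 2 k terms, so the limit theorem is read along the even
        numbers.\<close>
      have "filterlim (\<lambda>k::nat. 2 * k) sequentially sequentially"
        by (rule filterlim_subseq) (simp add: strict_mono_def)
      from filterlim_compose[OF char_power_tendsto[OF Wm W_moments(2,1), of t] this]
      show ?thesis unfolding normal_law_facts(3)[OF v0] unfolding v_eq .
    qed
    ultimately have "(\<lambda>k. char (distr M borel (S k)) t) \<longlonglongrightarrow> char (normal_law 0 v) t" by simp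
    then show "(\<lambda>k. char (distr M borel (S (Suc k))) t) \<longlonglongrightarrow> char (normal_law 0 v) t"
      by (rule LIMSEQ_Suc)
  qed
  then show "(\<lambda>k. wasserstein1
        (distr M borel (\<lambda>\<omega>. sqrt (real (2 * Suc k)) * (cv_risk (2 * Suc k) (B (2 * Suc k)) (\<lambda>i. X i \<omega>) - mean_risk M X (2 * Suc k div 2))))
        (normal_law 0 (q * (1 - q) + \<Delta>\<^sup>2 / 4 * obs_variance + 2 * \<rho>))) \<longlonglongrightarrow> 0"
    by (simp only: A_def[abs_def] v_def)
qed

end

section \<open>From conditional densities to the mixture formula, and the theorem\<close>

lemma (in prob_space) conditional_expectation_half:
  fixes \<phi> :: "real \<Rightarrow> real"
  assumes E: "E \<in> events" "prob E = 1 / 2"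
    and dist: "distributed (uniform_measure M E) lborel Z (\<lambda>z. ennreal (g z))"
    and \<phi> [measurable]: "\<phi> \<in> borel_measurable borel" and int: "integrable (law_of_density g) \<phi>"
  shows "has_bochner_integral M (\<lambda>\<omega>. indicator E \<omega> * \<phi> (Z \<omega>)) (1 / 2 * (\<integral>z. \<phi> z \<partial>law_of_density g))"
proof -
  have [measurable]: "E \<in> events" by (rule E)
  have half: "emeasure M E = ennreal (1 / 2)" unfolding emeasure_eq_measure E(2) ..
  \<comment> \<open>Conditioning on an event of probability 1/2 means passing to the density
    \<open>2 * indicator E\<close>; the factor 1/2 in the conclusion undoes this 2.\<close>
  have inv: "1 / emeasure M E = ennreal 2" unfolding half using divide_ennreal[of 1 "1 / 2"] by simp
  have dens: "uniform_measure M E = density M (\<lambda>\<omega>. ennreal (2 * indicator E \<omega>))"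
    unfolding uniform_measure_def by (intro density_cong) (auto simp: indicator_def inv)
  have law: "distr (uniform_measure M E) lborel Z = law_of_density g"
    and Zm: "Z \<in> measurable (uniform_measure M E) lborel"
    using dist by (auto simp: distributed_def law_of_density_def)
  have [measurable]: "Z \<in> borel_measurable M"
    using Zm by (simp add: measurable_def uniform_measure_def)
  have "integrable (uniform_measure M E) (\<lambda>\<omega>. \<phi> (Z \<omega>))"
    using int unfolding law[symmetric] by (subst (asm) integrable_distr_eq) (use Zm in auto)
  then have i: "integrable M (\<lambda>\<omega>. 2 * (indicator E \<omega> * \<phi> (Z \<omega>)))"
    unfolding dens by (subst (asm) integrable_density) (auto simp: mult.assoc)
  have "(\<integral>z. \<phi> z \<partial>law_of_density g) = (\<integral>\<omega>. \<phi> (Z \<omega>) \<partial>uniform_measure M E)"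
    unfolding law[symmetric] by (subst integral_distr) (use Zm in auto)
  also have "\<dots> = expectation (\<lambda>\<omega>. 2 * (indicator E \<omega> * \<phi> (Z \<omega>)))"
    unfolding dens by (subst integral_density) (auto simp: mult.assoc)
  finally show ?thesis using i by (simp add: has_bochner_integral_iff)
qed

theorem proposition7:
  fixes M :: "'a measure"
    and Y :: "nat \<Rightarrow> 'a \<Rightarrow> bool" and Z :: "nat \<Rightarrow> 'a \<Rightarrow> real" and X :: "nat \<Rightarrow> 'a \<Rightarrow> real \<times> bool"
    and F\<^sub>1 F\<^sub>2 g\<^sub>1 g\<^sub>2 :: "real \<Rightarrow> real"
    and B :: "nat \<Rightarrow> nat \<Rightarrow> nat set"
    and \<mu>\<^sub>1 \<mu>\<^sub>2 \<mu> \<Delta> q \<sigma>2 \<rho> :: real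
  assumes "prob_space M"
    and "X = (\<lambda>i \<omega>. (Z i \<omega>, Y i \<omega>))"
    and iid: "prob_space.indep_vars M (\<lambda>_. obs_space) X {1..}"
      "\<And>i. i \<ge> 1 \<Longrightarrow> distr M obs_space (X i) = distr M obs_space (X 1)"
    and bernoulli:
      "\<And>i. i \<ge> 1 \<Longrightarrow> distr M (count_space UNIV) (Y i) = measure_pmf (bernoulli_pmf (1/2))"
    and conditional_density:
      "\<And>i y. i \<ge> 1 \<Longrightarrow>
         distributed (uniform_measure M {\<omega> \<in> space M. Y i \<omega> = y}) lborel (Z i)
           (\<lambda>z. ennreal (of_bool y * g\<^sub>1 z + (1 - of_bool y) * g\<^sub>2 z))"
    and "cdf_with_continuous_density F\<^sub>1 g\<^sub>1" and "cdf_with_continuous_density F\<^sub>2 g\<^sub>2"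
    and "F\<^sub>1 \<noteq> F\<^sub>2"
    and finite_variance: "integrable (law_of_density g\<^sub>1) (\<lambda>z. z\<^sup>2)" "integrable (law_of_density g\<^sub>2) (\<lambda>z. z\<^sup>2)"
    and "\<mu>\<^sub>1 = expect g\<^sub>1 (\<lambda>z. z)" and "\<mu>\<^sub>2 = expect g\<^sub>2 (\<lambda>z. z)"
    and "\<mu>\<^sub>1 > \<mu>\<^sub>2"
    and folds: "\<And>n. even n \<Longrightarrow> two_folds n (B n)"
    and "\<mu> = (\<mu>\<^sub>1 + \<mu>\<^sub>2) / 2"
    and "\<Delta> = g\<^sub>1 \<mu> - g\<^sub>2 \<mu>"
    and "q = (F\<^sub>1 \<mu> - F\<^sub>2 \<mu> + 1) / 2"
    and "\<sigma>2 = \<Delta>\<^sup>2 / 8 * (var g\<^sub>1 + var g\<^sub>2 + 1/2 * (\<mu>\<^sub>1 - \<mu>\<^sub>2)\<^sup>2) + q * (1 - q)"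
    and "\<rho> = \<Delta> / 4 * (expect g\<^sub>2 (\<lambda>z. z * of_bool (z > \<mu>)) + expect g\<^sub>1 (\<lambda>z. z * of_bool (z \<le> \<mu>)) - 2 * q * \<mu>)"
  shows "((\<lambda>n. wasserstein1
             (distr M borel (\<lambda>\<omega>. sqrt (real n / 2) * (split_risk n (B n) (\<lambda>i. X i \<omega>) - mean_risk M X (n div 2))))
             (normal_law 0 \<sigma>2)) \<longlongrightarrow> 0) (inf at_top (principal {n. even n}))
       \<and> ((\<lambda>n. wasserstein1
             (distr M borel (\<lambda>\<omega>. sqrt (real n) * (cv_risk n (B n) (\<lambda>i. X i \<omega>) - mean_risk M X (n div 2))))
             (normal_law 0 (\<sigma>2 + 2 * \<rho>))) \<longlongrightarrow> 0) (inf at_top (principal {n. even n}))"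
proof -
  interpret prob_space M by fact
  \<comment> \<open>Label \<open>True\<close> is the first class, so \<open>g True\<close> is the
    density with the larger mean, as \<open>means_less\<close> demands.\<close>
  define g where "g c = (if c then g\<^sub>1 else g\<^sub>2)" for c :: bool
  have X_meas: "X i \<in> measurable M obs_space" if "i \<ge> 1" for i
    using iid(1) that by (auto simp: indep_vars_def)
  have g: "continuous_on UNIV (g c)" "0 \<le> g c z" "prob_space (law_of_density (g c))"
    "integrable (law_of_density (g c)) (\<lambda>z. z\<^sup>2)" for c z
    using assms(7,8) finite_variance by (auto simp: g_def cdf_with_continuous_density_def)
  have mixture: "has_bochner_integral M (\<lambda>\<omega>. of_bool (snd (X 1 \<omega>) = c) * \<phi> (fst (X 1 \<omega>)))
      (1/2 * (\<integral>z. \<phi> z \<partial>law_of_density (g c)))"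
    if \<phi>: "\<phi> \<in> borel_measurable borel" "integrable (law_of_density (g c)) \<phi>" for c and \<phi> :: "real \<Rightarrow> real"
  proof -
    have Y: "Y 1 \<in> measurable M (count_space UNIV)"
      using measurable_compose[OF X_meas[of 1] measurable_snd] by (simp add: assms(2))
    let ?E = "{\<omega> \<in> space M. Y 1 \<omega> = c}"
    have vim: "Y 1 -` {c} \<inter> space M = ?E" by auto
    have E: "?E \<in> events" using measurable_sets[OF Y, of "{c}"] unfolding vim by simp
    have "prob ?E = measure (distr M (count_space UNIV) (Y 1)) {c}"
      using measure_distr[OF Y, of "{c}"] unfolding vim by simp
    also have "\<dots> = 1 / 2"
      unfolding bernoulli[OF order_refl] by (cases c) (simp_all add: measure_pmf_single)
    finally have half: "prob ?E = 1 / 2" .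
    have "(\<lambda>z. ennreal (of_bool c * g\<^sub>1 z + (1 - of_bool c) * g\<^sub>2 z)) = (\<lambda>z. ennreal (g c z))"
      by (auto simp: g_def)
    then have dist: "distributed (uniform_measure M ?E) lborel (Z 1) (\<lambda>z. ennreal (g c z))"
      using conditional_density[of 1 c] by simp
    have "(\<lambda>\<omega>. of_bool (snd (X 1 \<omega>) = c) * \<phi> (fst (X 1 \<omega>))) = (\<lambda>\<omega>. of_bool (Y 1 \<omega> = c) * \<phi> (Z 1 \<omega>))"
      by (simp add: assms(2))
    moreover have "has_bochner_integral M (\<lambda>\<omega>. of_bool (Y 1 \<omega> = c) * \<phi> (Z 1 \<omega>)) I
        \<longleftrightarrow> has_bochner_integral M (\<lambda>\<omega>. indicator ?E \<omega> * \<phi> (Z 1 \<omega>)) I" for I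
      by (rule has_bochner_integral_cong) (auto simp: indicator_def)
    ultimately show ?thesis
      using conditional_expectation_half[OF E half dist \<phi>] by simp
  qed
  interpret S: labelled_sample M X g
  proof (intro labelled_sample.intro iid_sample.intro iid_sample_axioms.intro labelled_sample_axioms.intro)
    show "prob_space M" by fact
    show "indep_vars (\<lambda>_. obs_space) X {1..}" by (rule iid)
    show "distr M obs_space (X i) = distr M obs_space (X 1)" if "1 \<le> i" for i
      using that by (rule iid)
    show "expect (g False) (\<lambda>z. z) < expect (g True) (\<lambda>z. z)"
      using assms(12,13,14) by (simp add: g_def)
  qed (fact g mixture)+
  have means: "expect (g True) (\<lambda>z. z) = \<mu>\<^sub>1" "expect (g False) (\<lambda>z. z) = \<mu>\<^sub>2"
    using assms(12,13) by (simp_all add: g_def)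
  have gs: "g True = g\<^sub>1" "g False = g\<^sub>2" by (simp_all add: g_def)
  have cdfs: "cdf (law_of_density g\<^sub>1) = F\<^sub>1" "cdf (law_of_density g\<^sub>2) = F\<^sub>2"
    using assms(7,8) by (simp_all add: cdf_with_continuous_density_def)
  have \<mu>: "S.\<mu> = \<mu>" using assms(16) by (simp add: S.\<mu>_def means)
  have \<Delta>: "S.\<Delta> = \<Delta>" using assms(17) by (simp add: S.\<Delta>_def \<mu> gs)
  have q: "S.q = q" using assms(18) by (simp add: S.q_def S.r_def \<mu> gs cdfs)
  have \<rho>: "S.\<rho> = \<rho>" using assms(20) by (simp add: S.\<rho>_def \<Delta> \<mu> q gs)
  \<comment> \<open>The limit variance arose as a Bernoulli part plus the variance of
    \<open>V\<close>; \<open>V_variance\<close> rewrites the latter through the class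
    variances.\<close>
  have \<sigma>: "S.q * (1 - S.q) + S.\<Delta>\<^sup>2 / 4 * S.obs_variance = \<sigma>2"
    unfolding S.V_variance using assms(19) by (simp add: \<Delta> q gs means[unfolded gs])
  show ?thesis
    using S.split_limit[OF folds] S.cv_limit[OF folds] unfolding \<sigma> \<rho> by (rule conjI)
qed

end
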